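(* Let $G$ be a finitely generated virtually abelian group, with a finite-index normal free abelian subgroup $\mathbb{Z}^k$, let $T$ be a right transversal of $\mathbb{Z}^k$ in $G$, let $\Sigma=\{a_1^{\pm1},\ldots,a_k^{\pm1}\}$ be the standard generating set of $\mathbb{Z}^k$, and let $\zeta\colon G\to(\Sigma\cup T)^*$ be the normal form sending $g=a_1^{i_1}\cdots a_k^{i_k}t$ (with $i_1,\ldots,i_k\in\mathbb{Z}$, $t\in T$, uniquely determined by $g$) to the word $a_1^{i_1}\cdots a_k^{i_k}t$. Then the $\#$-joined solution language, with respect to $\Sigma\cup T$ and $\zeta$, of any finite system of equations in $G$ has rational growth series.
   Context: Functions are written to the right of their arguments. Equations: a finite system of equations in $G$ is a finite subset $\{w_1,\ldots,w_m\}$ of $G*F_V$, where $F_V$ is the free group on a finite set $V=\{X_1,\ldots,X_n\}$ of variables. A solution is a homomorphism $\psi\colon F_V\to G$ such that $w_1\bar\psi=\cdots=w_m\bar\psi=1_G$, where $\bar\psi\colon G*F_V\to G$ extends $\psi$ by the identity on $G$. The $\#$-joined solution language with respect to a finite monoid generating set $\Omega$ and a normal form $\eta\colon G\to\Omega^*$ (choosing a word representing each element) is $\{X_1\psi\eta\,\#\,X_2\psi\eta\,\#\cdots\#\,X_n\psi\eta\mid\psi\text{ a solution}\}\subseteq(\Omega\cup\{\#\})^*$, where $\#$ is a new letter. The growth series of a language $L$ over a finite alphabet is the formal power series $\sum_{m\ge0}\#\{w\in L\mid |w|=m\}\,z^m$, where $|w|$ is the length of the word $w$ (each letter, including each letter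 of $T$ and $\#$, counts as $1$). It is rational if it lies in the field of rational functions $\mathbb{Q}(z)$. *)

theory Defs
  imports
    "HOL-Algebra.Free_Abelian_Groups"
    "HOL-Algebra.Generated_Groups"
    "HOL-Computational_Algebra.Polynomial_FPS"
begin

section \<open>Monoid presentations\<close>

inductive_set word_cong :: "'c set \<Rightarrow> ('c list \<times> 'c list) set \<Rightarrow> ('c list \<times> 'c list) set"
  for A R where
    refl: "u \<in> lists A \<Longrightarrow> (u, u) \<in> word_cong A R"
  | sym: "(u, v) \<in> word_cong A R \<Longrightarrow> (v, u) \<in> word_cong A R"
  | trans: "(u, v) \<in> word_cong A R \<Longrightarrow> (v, w) \<in> word_cong A R \<Longrightarrow> (u, w) \<in> word_cong A R"
  | rel: "(u, v) \<in> R \<Longrightarrow> u \<in> lists A \<Longrightarrow> v \<in> lists A \<Longrightarrow> (u, v) \<in> word_cong A R"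
  | append: "(u, v) \<in> word_cong A R \<Longrightarrow> (u', v') \<in> word_cong A R
      \<Longrightarrow> (u @ u', v @ v') \<in> word_cong A R"

definition word_class :: "'c set \<Rightarrow> ('c list \<times> 'c list) set \<Rightarrow> 'c list \<Rightarrow> 'c list set" where
  "word_class A R u = word_cong A R `` {u}"

definition presented_monoid :: "'c set \<Rightarrow> ('c list \<times> 'c list) set \<Rightarrow> 'c list set monoid" where
  "presented_monoid A R =
     \<lparr> carrier = lists A // word_cong A R,
       monoid.mult = (\<lambda>X Y. \<Union>u\<in>X. \<Union>v\<in>Y. word_class A R (u @ v)),
       one = word_class A R [] \<rparr>"

definition eval_word :: "('m, 'z) monoid_scheme \<Rightarrow> ('c \<Rightarrow> 'm) \<Rightarrow> 'c list \<Rightarrow> 'm" where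
  "eval_word M f u = foldr (\<lambda>c x. f c \<otimes>\<^bsub>M\<^esub> x) u \<one>\<^bsub>M\<^esub>"

lemma word_cong_lists:
  assumes "(u, v) \<in> word_cong A R"
  shows "u \<in> lists A \<and> v \<in> lists A"
  using assms by induction auto

lemma equiv_word_cong: "equiv (lists A) (word_cong A R)"
proof (rule equivI)
  show "word_cong A R \<subseteq> lists A \<times> lists A"
    using word_cong_lists by fast
  show "refl_on (lists A) (word_cong A R)"
    by (rule refl_onI) (rule word_cong.refl)
  show "sym (word_cong A R)"
    by (rule symI) (rule word_cong.sym)
  show "trans (word_cong A R)"
    by (rule transI) (rule word_cong.trans)
qed

lemma word_class_eq_iff:
  assumes "u \<in> lists A" "v \<in> lists A"
  shows "word_class A R u = word_class A R v \<longleftrightarrow> (u, v) \<in> word_cong A R"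
  unfolding word_class_def using eq_equiv_class_iff[OF equiv_word_cong assms] .

lemma carrier_presented: "carrier (presented_monoid A R) = word_class A R ` lists A"
  by (auto simp: presented_monoid_def quotient_def word_class_def)

lemma one_presented: "\<one>\<^bsub>presented_monoid A R\<^esub> = word_class A R []"
  by (simp add: presented_monoid_def)

lemma mult_presented:
  assumes "u \<in> lists A" "v \<in> lists A"
  shows "word_class A R u \<otimes>\<^bsub>presented_monoid A R\<^esub> word_class A R v = word_class A R (u @ v)"
proof -
  have *: "word_class A R (x @ y) = word_class A R (u @ v)"
    if "x \<in> word_class A R u" "y \<in> word_class A R v" for x y
  proof -
    have x: "(u, x) \<in> word_cong A R" and y: "(v, y) \<in> word_cong A R"
      using that by (auto simp: word_class_def)
    have xy: "(x @ y, u @ v) \<in> word_cong A R"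
      using word_cong.append[OF word_cong.sym[OF x] word_cong.sym[OF y]] .
    show ?thesis
      using xy word_class_eq_iff[of "x @ y" A "u @ v" R] word_cong_lists[OF xy] by simp
  qed
  have ne: "u \<in> word_class A R u" "v \<in> word_class A R v"
    using assms unfolding word_class_def by (simp_all add: word_cong.refl)
  have "word_class A R u \<otimes>\<^bsub>presented_monoid A R\<^esub> word_class A R v
      = (\<Union>x\<in>word_class A R u. \<Union>y\<in>word_class A R v. word_class A R (x @ y))"
    by (simp add: presented_monoid_def)
  also have "\<dots> = (\<Union>x\<in>word_class A R u. \<Union>y\<in>word_class A R v. word_class A R (u @ v))"
    by (intro SUP_cong HOL.refl) (rule *)
  also have "\<dots> = word_class A R (u @ v)"
    using ne by blast
  finally show ?thesis .
qed

lemma monoid_presented: "monoid (presented_monoid A R)"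
proof (rule monoidI)
  fix x y z
  assume "x \<in> carrier (presented_monoid A R)" "y \<in> carrier (presented_monoid A R)"
    "z \<in> carrier (presented_monoid A R)"
  then obtain u v w where "u \<in> lists A" "v \<in> lists A" "w \<in> lists A"
    "x = word_class A R u" "y = word_class A R v" "z = word_class A R w"
    unfolding carrier_presented by (elim imageE)
  then show "x \<otimes>\<^bsub>presented_monoid A R\<^esub> y \<otimes>\<^bsub>presented_monoid A R\<^esub> z
      = x \<otimes>\<^bsub>presented_monoid A R\<^esub> (y \<otimes>\<^bsub>presented_monoid A R\<^esub> z)"
    using mult_presented[of "u @ v" A w R] mult_presented[of u A "v @ w" R] mult_presented[of u A v R]
      mult_presented[of v A w R] by simp
next
  fix x y
  assume "x \<in> carrier (presented_monoid A R)" "y \<in> carrier (presented_monoid A R)"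
  then obtain u v where "u \<in> lists A" "v \<in> lists A"
    "x = word_class A R u" "y = word_class A R v"
    unfolding carrier_presented by (elim imageE)
  then show "x \<otimes>\<^bsub>presented_monoid A R\<^esub> y \<in> carrier (presented_monoid A R)"
    using mult_presented[of u A v R] by (simp add: carrier_presented)
next
  show "\<one>\<^bsub>presented_monoid A R\<^esub> \<in> carrier (presented_monoid A R)"
    by (simp add: carrier_presented one_presented)
next
  fix x
  assume "x \<in> carrier (presented_monoid A R)"
  then obtain u where "u \<in> lists A" "x = word_class A R u"
    unfolding carrier_presented by (elim imageE)
  then show "\<one>\<^bsub>presented_monoid A R\<^esub> \<otimes>\<^bsub>presented_monoid A R\<^esub> x = x"
    and "x \<otimes>\<^bsub>presented_monoid A R\<^esub> \<one>\<^bsub>presented_monoid A R\<^esub> = x"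
    using mult_presented[of u A "[]" R] mult_presented[of "[]" A u R] by (simp_all add: one_presented)
qed

lemma eval_word_append:
  assumes "monoid M" "f \<in> A \<rightarrow> carrier M" "u \<in> lists A" "v \<in> lists A"
  shows "eval_word M f u \<in> carrier M"
    and "eval_word M f (u @ v) = eval_word M f u \<otimes>\<^bsub>M\<^esub> eval_word M f v"
proof -
  interpret monoid M by fact
  have c: "eval_word M f u \<in> carrier M" if "u \<in> lists A" for u
    using that by (induction u) (use assms(2) in \<open>auto simp: eval_word_def\<close>)
  show "eval_word M f u \<in> carrier M" using c assms(3) .
  show "eval_word M f (u @ v) = eval_word M f u \<otimes>\<^bsub>M\<^esub> eval_word M f v"
    using assms(3)
  proof (induction u)
    case Nil
    then show ?case using c[OF assms(4)] by (simp add: eval_word_def)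
  next
    case (Cons a u)
    then show ?case using c[of u] c[OF assms(4)] assms(2)
      by (auto simp: eval_word_def m_assoc Pi_iff)
  qed
qed

lemma presented_lift:
  assumes M: "monoid M" and f: "f \<in> A \<rightarrow> carrier M"
    and R: "\<And>u v. (u, v) \<in> R \<Longrightarrow> u \<in> lists A \<Longrightarrow> v \<in> lists A \<Longrightarrow> eval_word M f u = eval_word M f v"
  obtains h where "h \<in> hom (presented_monoid A R) M"
    and "\<And>u. u \<in> lists A \<Longrightarrow> h (word_class A R u) = eval_word M f u"
proof -
  have resp: "eval_word M f u = eval_word M f v" if "(u, v) \<in> word_cong A R" for u v
    using that
  proof induction
    case (append u v u' v')
    then show ?case
      using eval_word_append(2)[OF M f] word_cong_lists by metis
  qed (auto simp: R)
  define h where "h X = (THE z. \<exists>u\<in>lists A. X = word_class A R u \<and> z = eval_word M f u)" for X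
  have h: "h (word_class A R u) = eval_word M f u" if "u \<in> lists A" for u
    unfolding h_def
    by (rule the_equality) (use that resp word_class_eq_iff in metis)+
  have "h \<in> hom (presented_monoid A R) M"
  proof (rule homI)
    fix x assume "x \<in> carrier (presented_monoid A R)"
    then show "h x \<in> carrier M"
      using h eval_word_append(1)[OF M f] unfolding carrier_presented by (metis imageE)
  next
    fix x y assume "x \<in> carrier (presented_monoid A R)" "y \<in> carrier (presented_monoid A R)"
    then obtain u v where uv: "u \<in> lists A" "v \<in> lists A" "x = word_class A R u" "y = word_class A R v"
      by (auto simp: carrier_presented)
    then have "u @ v \<in> lists A" by simp
    with uv show "h (x \<otimes>\<^bsub>presented_monoid A R\<^esub> y) = h x \<otimes>\<^bsub>M\<^esub> h y"
      using h eval_word_append(2)[OF M f] mult_presented by metis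
  qed
  with h that show thesis by blast
qed

lemma group_presented:
  assumes "\<And>c. c \<in> A \<Longrightarrow> \<exists>d\<in>A. ([d, c], []) \<in> word_cong A R"
  shows "group (presented_monoid A R)"
proof -
  interpret monoid "presented_monoid A R" by (rule monoid_presented)
  have inv: "\<exists>v\<in>lists A. (v @ u, []) \<in> word_cong A R" if "u \<in> lists A" for u
    using that
  proof (induction u)
    case Nil
    then show ?case by (auto intro!: bexI[of _ "[]"] word_cong.refl)
  next
    case (Cons c u)
    then obtain v d where v: "v \<in> lists A" "(v @ u, []) \<in> word_cong A R"
      and d: "d \<in> A" "([d, c], []) \<in> word_cong A R"
      using assms by blast
    have "(v @ ([d, c] @ u), v @ ([] @ u)) \<in> word_cong A R"
      using v d Cons by (intro word_cong.append word_cong.refl) auto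
    then have "((v @ [d]) @ (c # u), []) \<in> word_cong A R"
      using v(2) word_cong.trans by fastforce
    then show ?case using v d by (intro bexI[of _ "v @ [d]"]) auto
  qed
  show ?thesis
  proof (rule groupI)
    fix x assume "x \<in> carrier (presented_monoid A R)"
    then obtain u where u: "u \<in> lists A" "x = word_class A R u"
      by (auto simp: carrier_presented)
    from inv[OF u(1)] obtain v where v: "v \<in> lists A" "(v @ u, []) \<in> word_cong A R" by blast
    then have "word_class A R v \<otimes>\<^bsub>presented_monoid A R\<^esub> x = \<one>\<^bsub>presented_monoid A R\<^esub>"
      using u by (simp add: mult_presented one_presented word_class_eq_iff)
    then show "\<exists>y\<in>carrier (presented_monoid A R).
        y \<otimes>\<^bsub>presented_monoid A R\<^esub> x = \<one>\<^bsub>presented_monoid A R\<^esub>"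
      using v by (auto simp: carrier_presented)
  qed (simp_all add: m_assoc)
qed

lemma presented_hom_unique:
  assumes G: "group (presented_monoid A R)" and H: "group H"
    and h: "h \<in> hom (presented_monoid A R) H" and h': "h' \<in> hom (presented_monoid A R) H"
    and eq: "\<And>c. c \<in> A \<Longrightarrow> h (word_class A R [c]) = h' (word_class A R [c])"
    and x: "x \<in> carrier (presented_monoid A R)"
  shows "h x = h' x"
proof -
  have "h (word_class A R u) = h' (word_class A R u)" if "u \<in> lists A" for u
    using that
  proof (induction u)
    case Nil
    then show ?case
      using hom_one[OF h G H] hom_one[OF h' G H] by (simp add: one_presented)
  next
    case (Cons c u)
    have cc: "[c] \<in> lists A" using Cons by simp
    have "word_class A R (c # u)
        = word_class A R [c] \<otimes>\<^bsub>presented_monoid A R\<^esub> word_class A R u"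
      using mult_presented[OF cc Cons(2)] by simp
    then show ?case
      using hom_mult[OF h] hom_mult[OF h'] Cons eq cc by (simp add: carrier_presented)
  qed
  then show ?thesis using x by (auto simp: carrier_presented)
qed


section \<open>Free groups and free products\<close>

text \<open>The letter \<open>(x, True)\<close> stands for the variable \<open>x\<close>, and \<open>(x, False)\<close> for its inverse.\<close>

definition free_group_rels :: "'v set \<Rightarrow> (('v \<times> bool) list \<times> ('v \<times> bool) list) set" where
  "free_group_rels V = {([(x, b), (x, \<not> b)], []) | x b. x \<in> V}"

definition free_group :: "'v set \<Rightarrow> ('v \<times> bool) list set monoid" where
  "free_group V = presented_monoid (V \<times> UNIV) (free_group_rels V)"

definition free_gen :: "'v set \<Rightarrow> 'v \<Rightarrow> ('v \<times> bool) list set" where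
  "free_gen V x = word_class (V \<times> UNIV) (free_group_rels V) [(x, True)]"

definition free_product_rels ::
  "('a, 'b) monoid_scheme \<Rightarrow> ('c, 'd) monoid_scheme \<Rightarrow> (('a + 'c) list \<times> ('a + 'c) list) set" where
  "free_product_rels G H =
     {([Inl x, Inl y], [Inl (x \<otimes>\<^bsub>G\<^esub> y)]) | x y. x \<in> carrier G \<and> y \<in> carrier G}
     \<union> {([Inr x, Inr y], [Inr (x \<otimes>\<^bsub>H\<^esub> y)]) | x y. x \<in> carrier H \<and> y \<in> carrier H}
     \<union> {([Inl \<one>\<^bsub>G\<^esub>], []), ([Inr \<one>\<^bsub>H\<^esub>], [])}"

definition free_product ::
  "('a, 'b) monoid_scheme \<Rightarrow> ('c, 'd) monoid_scheme \<Rightarrow> ('a + 'c) list set monoid" where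
  "free_product G H = presented_monoid (carrier G <+> carrier H) (free_product_rels G H)"

definition free_product_inl ::
  "('a, 'b) monoid_scheme \<Rightarrow> ('c, 'd) monoid_scheme \<Rightarrow> 'a \<Rightarrow> ('a + 'c) list set" where
  "free_product_inl G H x = word_class (carrier G <+> carrier H) (free_product_rels G H) [Inl x]"

definition free_product_inr ::
  "('a, 'b) monoid_scheme \<Rightarrow> ('c, 'd) monoid_scheme \<Rightarrow> 'c \<Rightarrow> ('a + 'c) list set" where
  "free_product_inr G H y = word_class (carrier G <+> carrier H) (free_product_rels G H) [Inr y]"

lemma group_free_group: "group (free_group V)"
  unfolding free_group_def
proof (rule group_presented)
  fix c :: "'a \<times> bool" assume "c \<in> V \<times> UNIV"
  then obtain x b where c: "c = (x, b)" "x \<in> V" by auto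
  have "([(x, \<not> b), (x, \<not> (\<not> b))], []) \<in> word_cong (V \<times> UNIV) (free_group_rels V)"
    using c by (intro word_cong.rel) (auto simp: free_group_rels_def)
  then show "\<exists>d\<in>V \<times> UNIV. ([d, c], []) \<in> word_cong (V \<times> UNIV) (free_group_rels V)"
    using c by (intro bexI[of _ "(x, \<not> b)"]) auto
qed

lemma free_gen_closed: "x \<in> V \<Longrightarrow> free_gen V x \<in> carrier (free_group V)"
  by (auto simp: free_group_def free_gen_def carrier_presented)

lemma free_group_lift:
  assumes "group H" and f: "f \<in> V \<rightarrow> carrier H"
  obtains h where "h \<in> hom (free_group V) H" and "\<And>x. x \<in> V \<Longrightarrow> h (free_gen V x) = f x"
proof -
  interpret group H by fact
  define f' where "f' = (\<lambda>(x, b). if b then f x else inv\<^bsub>H\<^esub> (f x))"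
  have f': "f' \<in> V \<times> UNIV \<rightarrow> carrier H" using f by (auto simp: f'_def Pi_iff)
  have "eval_word H f' u = eval_word H f' v" if "(u, v) \<in> free_group_rels V" for u v
    using that f by (auto simp: free_group_rels_def f'_def eval_word_def Pi_iff)
  then obtain h where "h \<in> hom (free_group V) H"
    and h: "\<And>u. u \<in> lists (V \<times> UNIV) \<Longrightarrow>
      h (word_class (V \<times> UNIV) (free_group_rels V) u) = eval_word H f' u"
    using presented_lift[OF monoid_axioms f', of "free_group_rels V"]
    unfolding free_group_def by metis
  moreover have "h (free_gen V x) = f x" if "x \<in> V" for x
    using h[of "[(x, True)]"] that f by (auto simp: free_gen_def eval_word_def f'_def Pi_iff)
  ultimately show thesis using that by blast
qed

lemma free_group_hom_unique:
  assumes H: "group H" and h: "h \<in> hom (free_group V) H" and h': "h' \<in> hom (free_group V) H"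
    and eq: "\<And>x. x \<in> V \<Longrightarrow> h (free_gen V x) = h' (free_gen V x)"
    and x: "x \<in> carrier (free_group V)"
  shows "h x = h' x"
proof -
  interpret F: group "free_group V" by (rule group_free_group)
  interpret h: group_hom "free_group V" H h
    using H h F.group_axioms by (simp add: group_hom_def group_hom_axioms_def)
  interpret h': group_hom "free_group V" H h'
    using H h' F.group_axioms by (simp add: group_hom_def group_hom_axioms_def)
  let ?c = "word_class (V \<times> UNIV) (free_group_rels V)"
  have inv: "?c [(y, False)] = inv\<^bsub>free_group V\<^esub> (free_gen V y)" if "y \<in> V" for y
  proof (rule F.inv_equality[symmetric])
    have "([(y, False), (y, True)], []) \<in> word_cong (V \<times> UNIV) (free_group_rels V)"
      using that by (intro word_cong.rel) (auto simp: free_group_rels_def)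
    then show "?c [(y, False)] \<otimes>\<^bsub>free_group V\<^esub> free_gen V y = \<one>\<^bsub>free_group V\<^esub>"
      using that by (simp add: free_group_def free_gen_def mult_presented one_presented word_class_eq_iff)
  qed (use that in \<open>auto simp: free_group_def carrier_presented free_gen_def\<close>)
  have "h (?c [c]) = h' (?c [c])" if cV: "c \<in> V \<times> UNIV" for c
  proof -
    obtain y b where c: "c = (y, b)" "y \<in> V" using cV by blast
    show ?thesis
    proof (cases b)
      case True
      then show ?thesis using eq[OF c(2)] c by (simp add: free_gen_def)
    next
      case False
      then show ?thesis
        using eq[OF c(2)] c inv[OF c(2)] free_gen_closed[OF c(2)] h.hom_inv h'.hom_inv by auto
    qed
  qed
  then show ?thesis
    using presented_hom_unique[OF _ H, of "V \<times> UNIV" "free_group_rels V" h h' x]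
      group_free_group[of V] h h' x by (simp add: free_group_def)
qed

lemma group_free_product:
  assumes "group G" "group H"
  shows "group (free_product G H)"
  unfolding free_product_def
proof (rule group_presented)
  interpret G: group G by fact
  interpret H: group H by fact
  let ?A = "carrier G <+> carrier H" and ?R = "free_product_rels G H"
  fix c assume "c \<in> ?A"
  then consider x where "c = Inl x" "x \<in> carrier G" | x where "c = Inr x" "x \<in> carrier H" by auto
  then show "\<exists>d\<in>?A. ([d, c], []) \<in> word_cong ?A ?R"
  proof cases
    case 1
    have "([Inl (inv\<^bsub>G\<^esub> x), Inl x], [Inl (inv\<^bsub>G\<^esub> x \<otimes>\<^bsub>G\<^esub> x)]) \<in> word_cong ?A ?R"
      using 1 by (intro word_cong.rel) (auto simp: free_product_rels_def)
    moreover have "([Inl \<one>\<^bsub>G\<^esub>], []) \<in> word_cong ?A ?R"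
      by (intro word_cong.rel) (auto simp: free_product_rels_def)
    ultimately have "([Inl (inv\<^bsub>G\<^esub> x), Inl x], []) \<in> word_cong ?A ?R"
      using 1 by (auto intro: word_cong.trans)
    then show ?thesis using 1 by (intro bexI[of _ "Inl (inv\<^bsub>G\<^esub> x)"]) auto
  next
    case 2
    have "([Inr (inv\<^bsub>H\<^esub> x), Inr x], [Inr (inv\<^bsub>H\<^esub> x \<otimes>\<^bsub>H\<^esub> x)]) \<in> word_cong ?A ?R"
      using 2 by (intro word_cong.rel) (auto simp: free_product_rels_def)
    moreover have "([Inr \<one>\<^bsub>H\<^esub>], []) \<in> word_cong ?A ?R"
      by (intro word_cong.rel) (auto simp: free_product_rels_def)
    ultimately have "([Inr (inv\<^bsub>H\<^esub> x), Inr x], []) \<in> word_cong ?A ?R"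
      using 2 by (auto intro: word_cong.trans)
    then show ?thesis using 2 by (intro bexI[of _ "Inr (inv\<^bsub>H\<^esub> x)"]) auto
  qed
qed

lemma free_product_lift:
  assumes "group G" "group H" "group K" and f: "f \<in> hom G K" and g: "g \<in> hom H K"
  obtains h where "h \<in> hom (free_product G H) K"
    and "\<And>x. x \<in> carrier G \<Longrightarrow> h (free_product_inl G H x) = f x"
    and "\<And>y. y \<in> carrier H \<Longrightarrow> h (free_product_inr G H y) = g y"
proof -
  interpret K: group K by fact
  let ?A = "carrier G <+> carrier H" and ?R = "free_product_rels G H"
  have fg: "case_sum f g \<in> ?A \<rightarrow> carrier K"
    using hom_carrier[OF f] hom_carrier[OF g] by auto
  have fc: "f x \<in> carrier K" if "x \<in> carrier G" for x using hom_carrier[OF f] that by auto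
  have gc: "g x \<in> carrier K" if "x \<in> carrier H" for x using hom_carrier[OF g] that by auto
  have "eval_word K (case_sum f g) u = eval_word K (case_sum f g) v" if "(u, v) \<in> ?R" for u v
    using that fc gc hom_mult[OF f] hom_mult[OF g]
      hom_one[OF f assms(1,3)] hom_one[OF g assms(2,3)]
      group.is_monoid[OF assms(1)] group.is_monoid[OF assms(2)]
    by (auto simp: free_product_rels_def eval_word_def K.m_assoc monoid.m_closed)
  then obtain h where "h \<in> hom (free_product G H) K"
    and h: "\<And>u. u \<in> lists ?A \<Longrightarrow> h (word_class ?A ?R u) = eval_word K (case_sum f g) u"
    using presented_lift[OF K.monoid_axioms fg, of ?R] unfolding free_product_def by metis
  moreover have "h (free_product_inl G H x) = f x" if "x \<in> carrier G" for x
    using h[of "[Inl x]"] that fc by (auto simp: free_product_inl_def eval_word_def)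
  moreover have "h (free_product_inr G H y) = g y" if "y \<in> carrier H" for y
    using h[of "[Inr y]"] that gc by (auto simp: free_product_inr_def eval_word_def)
  ultimately show thesis using that by blast
qed

lemma free_product_hom_unique:
  assumes "group G" "group H" "group K"
    and "h \<in> hom (free_product G H) K" "h' \<in> hom (free_product G H) K"
    and "\<And>x. x \<in> carrier G \<Longrightarrow> h (free_product_inl G H x) = h' (free_product_inl G H x)"
    and "\<And>y. y \<in> carrier H \<Longrightarrow> h (free_product_inr G H y) = h' (free_product_inr G H y)"
    and "x \<in> carrier (free_product G H)"
  shows "h x = h' x"
  using presented_hom_unique[OF _ assms(3), of "carrier G <+> carrier H" "free_product_rels G H" h h' x]
    group_free_product[OF assms(1,2)] assms(4-)
  by (auto simp: free_product_def free_product_inl_def free_product_inr_def)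


section \<open>Equations\<close>

definition extends_by_identity ::
  "('a, 'b) monoid_scheme \<Rightarrow> ('c, 'd) monoid_scheme \<Rightarrow> ('c \<Rightarrow> 'a) \<Rightarrow> (('a + 'c) list set \<Rightarrow> 'a) \<Rightarrow> bool"
where
  "extends_by_identity G F \<psi> \<psi>' \<longleftrightarrow>
     \<psi>' \<in> hom (free_product G F) G
     \<and> (\<forall>g\<in>carrier G. \<psi>' (free_product_inl G F g) = g)
     \<and> (\<forall>u\<in>carrier F. \<psi>' (free_product_inr G F u) = \<psi> u)"

lemma extends_by_identity_ex:
  assumes "group G" "group F" "\<psi> \<in> hom F G"
  shows "\<exists>\<psi>'. extends_by_identity G F \<psi> \<psi>'"
proof -
  have "(\<lambda>g. g) \<in> hom G G" by (auto intro: homI)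
  then show ?thesis
    using free_product_lift[OF assms(1,2,1) _ assms(3)] unfolding extends_by_identity_def by metis
qed

lemma extends_by_identity_unique:
  assumes "group G" "group F" "extends_by_identity G F \<psi> \<psi>'" "extends_by_identity G F \<psi> \<psi>''"
    and "x \<in> carrier (free_product G F)"
  shows "\<psi>' x = \<psi>'' x"
  using assms free_product_hom_unique[OF assms(1,2,1), of \<psi>' \<psi>'' x]
  by (simp add: extends_by_identity_def)

definition finite_system ::
  "('a, 'b) monoid_scheme \<Rightarrow> 'v set \<Rightarrow> ('a + ('v \<times> bool) list set) list set set \<Rightarrow> bool" where
  "finite_system G V W \<longleftrightarrow> finite W \<and> W \<subseteq> carrier (free_product G (free_group V))"

definition is_solution ::
  "('a, 'b) monoid_scheme \<Rightarrow> 'v set \<Rightarrow> ('a + ('v \<times> bool) list set) list set set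
    \<Rightarrow> (('v \<times> bool) list set \<Rightarrow> 'a) \<Rightarrow> bool" where
  "is_solution G V W \<psi> \<longleftrightarrow>
     \<psi> \<in> hom (free_group V) G
     \<and> (\<exists>\<psi>'. extends_by_identity G (free_group V) \<psi> \<psi>' \<and> (\<forall>w\<in>W. \<psi>' w = \<one>\<^bsub>G\<^esub>))"


section \<open>Solution languages and growth series\<close>

datatype 'a letter = Letter 'a | Hash

fun hash_join :: "'a list list \<Rightarrow> 'a letter list" where
  "hash_join [] = []"
| "hash_join [w] = map Letter w"
| "hash_join (w # v # ws) = map Letter w @ Hash # hash_join (v # ws)"

text \<open>The variables are \<open>X\<^sub>1, \<dots>, X\<^sub>n\<close>, indexed by \<open>{1..n}\<close>; the letters of a generating set are
  the generators themselves, as elements of the group.\<close>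

definition joined_solution_language ::
  "('a, 'b) monoid_scheme \<Rightarrow> nat \<Rightarrow> ('a \<Rightarrow> 'a list)
    \<Rightarrow> ('a + (nat \<times> bool) list set) list set set \<Rightarrow> 'a letter list set" where
  "joined_solution_language G n \<eta> W =
     {hash_join (map (\<lambda>i. \<eta> (\<psi> (free_gen {1..n} i))) [1..<Suc n]) | \<psi>. is_solution G {1..n} W \<psi>}"

text \<open>The coefficients are only meaningful for languages over a finite alphabet, as the
  cardinality of an infinite set is \<open>0\<close>.\<close>

definition growth_series :: "'c list set \<Rightarrow> rat fps" where
  "growth_series L = Abs_fps (\<lambda>m. of_nat (card {w \<in> L. length w = m}))"

text \<open>\<open>f\<close>, as an element of the field of formal Laurent series, is a quotient of two polynomials.
  The denominator may vanish at \<open>0\<close>, so \<open>f\<close> is characterised by \<open>q f = p\<close> rather than by division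
  of power series.\<close>

definition rational_fps :: "rat fps \<Rightarrow> bool" where
  "rational_fps f \<longleftrightarrow> (\<exists>p q. q \<noteq> 0 \<and> fps_of_poly q * f = fps_of_poly p)"

lemma set_hash_join: "set (hash_join ws) \<subseteq> insert Hash (Letter ` (\<Union>w\<in>set ws. set w))"
  by (induction ws rule: hash_join.induct) auto

lemma joined_solution_language_over:
  assumes "\<And>g. g \<in> carrier G \<Longrightarrow> \<eta> g \<in> lists \<Omega>"
  shows "joined_solution_language G n \<eta> W \<subseteq> lists (insert Hash (Letter ` \<Omega>))"
proof
  fix w assume "w \<in> joined_solution_language G n \<eta> W"
  then obtain \<psi> where \<psi>: "\<psi> \<in> hom (free_group {1..n}) G"
    and w: "w = hash_join (map (\<lambda>i. \<eta> (\<psi> (free_gen {1..n} i))) [1..<Suc n])"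
    by (auto simp: joined_solution_language_def is_solution_def)
  have "set (\<eta> (\<psi> (free_gen {1..n} i))) \<subseteq> \<Omega>" if "i \<in> {1..n}" for i
    using assms hom_carrier[OF \<psi>] free_gen_closed[OF that] by blast
  then have "(\<Union>v\<in>set (map (\<lambda>i. \<eta> (\<psi> (free_gen {1..n} i))) [1..<Suc n]). set v) \<subseteq> \<Omega>"
    by (force simp del: upt_Suc One_nat_def)
  then have "set w \<subseteq> insert Hash (Letter ` \<Omega>)"
    unfolding w using set_hash_join by (meson image_mono insert_mono order_trans)
  then show "w \<in> lists (insert Hash (Letter ` \<Omega>))"
    unfolding in_lists_conv_set by blast
qed


section \<open>Virtually abelian groups and the normal form\<close>

definition finitely_generated :: "('a, 'b) monoid_scheme \<Rightarrow> bool" where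
  "finitely_generated G \<longleftrightarrow> (\<exists>S. finite S \<and> S \<subseteq> carrier G \<and> generate G S = carrier G)"

text \<open>\<open>N\<close> is free abelian of rank \<open>k\<close> with basis \<open>a 1, \<dots>, a k\<close>.\<close>

definition free_abelian_basis ::
  "('a, 'b) monoid_scheme \<Rightarrow> 'a set \<Rightarrow> nat \<Rightarrow> (nat \<Rightarrow> 'a) \<Rightarrow> bool" where
  "free_abelian_basis G N k a \<longleftrightarrow>
     (\<exists>\<phi> \<in> iso (free_Abelian_group {1..k}) (G\<lparr>carrier := N\<rparr>). \<forall>i\<in>{1..k}. a i = \<phi> (frag_of i))"

definition right_transversal :: "('a, 'b) monoid_scheme \<Rightarrow> 'a set \<Rightarrow> 'a set \<Rightarrow> bool" where
  "right_transversal G N T \<longleftrightarrow> T \<subseteq> carrier G \<and> (\<forall>C\<in>rcosets\<^bsub>G\<^esub> N. \<exists>!t. t \<in> T \<inter> C)"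

definition signed_basis :: "('a, 'b) monoid_scheme \<Rightarrow> nat \<Rightarrow> (nat \<Rightarrow> 'a) \<Rightarrow> 'a set" where
  "signed_basis G k a = a ` {1..k} \<union> (\<lambda>i. inv\<^bsub>G\<^esub> (a i)) ` {1..k}"

definition basis_product ::
  "('a, 'b) monoid_scheme \<Rightarrow> nat \<Rightarrow> (nat \<Rightarrow> 'a) \<Rightarrow> (nat \<Rightarrow> int) \<Rightarrow> 'a" where
  "basis_product G k a e = foldr (\<otimes>\<^bsub>G\<^esub>) (map (\<lambda>j. a j [^]\<^bsub>G\<^esub> e j) [1..<Suc k]) \<one>\<^bsub>G\<^esub>"

definition power_word :: "('a, 'b) monoid_scheme \<Rightarrow> 'a \<Rightarrow> int \<Rightarrow> 'a list" where
  "power_word G x m = (if m \<ge> 0 then replicate (nat m) x else replicate (nat (- m)) (inv\<^bsub>G\<^esub> x))"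

definition basis_word ::
  "('a, 'b) monoid_scheme \<Rightarrow> nat \<Rightarrow> (nat \<Rightarrow> 'a) \<Rightarrow> (nat \<Rightarrow> int) \<Rightarrow> 'a list" where
  "basis_word G k a e = concat (map (\<lambda>j. power_word G (a j) (e j)) [1..<Suc k])"

text \<open>The final letter \<open>t\<close> is present for every group element, also when \<open>t = \<one>\<close>.\<close>

definition zeta ::
  "('a, 'b) monoid_scheme \<Rightarrow> nat \<Rightarrow> (nat \<Rightarrow> 'a) \<Rightarrow> 'a set \<Rightarrow> 'a \<Rightarrow> 'a list" where
  "zeta G k a T g =
     (THE w. \<exists>e. \<exists>t\<in>T. g = basis_product G k a e \<otimes>\<^bsub>G\<^esub> t \<and> w = basis_word G k a e @ [t])"

lemma basis_product_iso:
  assumes G: "group G" and N: "subgroup N G"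
    and \<phi>: "\<phi> \<in> hom (free_Abelian_group {1..k}) (G\<lparr>carrier := N\<rparr>)"
    and a: "\<And>i. i \<in> {1..k} \<Longrightarrow> a i = \<phi> (frag_of i)"
  shows "basis_product G k a e = \<phi> (\<Sum>j\<in>{1..k}. frag_cmul (e j) (frag_of j))"
proof -
  interpret G: group G by fact
  let ?F = "free_Abelian_group {1..k}" and ?N = "G\<lparr>carrier := N\<rparr>"
  have N': "group ?N" using G.subgroup_imp_group[OF N] .
  have pow: "\<phi> (frag_cmul m (frag_of j)) = a j [^]\<^bsub>G\<^esub> m" if j: "j \<in> {1..k}" for j and m :: int
  proof -
    have jF: "frag_of j \<in> carrier ?F" using j by simp
    have "\<phi> (frag_of j) \<in> N" using hom_carrier[OF \<phi>] jF by fastforce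
    then have "a j [^]\<^bsub>G\<^esub> m = \<phi> (frag_of j) [^]\<^bsub>?N\<^esub> m"
      using a[OF j] G.int_pow_consistent[OF N] by metis
    also have "\<dots> = \<phi> (frag_of j [^]\<^bsub>?F\<^esub> m)"
      using hom_int_pow[OF \<phi> jF _ N'] by simp
    also have "\<dots> = \<phi> (frag_cmul m (frag_of j))"
      using jF by (subst int_pow_free_Abelian_group) auto
    finally show ?thesis by simp
  qed
  have "foldr (\<otimes>\<^bsub>G\<^esub>) (map (\<lambda>j. a j [^]\<^bsub>G\<^esub> e j) xs) \<one>\<^bsub>G\<^esub>
      = \<phi> (\<Sum>j\<leftarrow>xs. frag_cmul (e j) (frag_of j))
    \<and> (\<Sum>j\<leftarrow>xs. frag_cmul (e j) (frag_of j)) \<in> carrier ?F" if "set xs \<subseteq> {1..k}" for xs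
    using that
  proof (induction xs)
    case Nil
    then show ?case using hom_one[OF \<phi> _ N'] by simp
  next
    case (Cons j xs)
    let ?s = "\<Sum>j\<leftarrow>xs. frag_cmul (e j) (frag_of j)"
    have j: "j \<in> {1..k}" and xs: "set xs \<subseteq> {1..k}" using Cons.prems by auto
    have jF: "frag_cmul (e j) (frag_of j) \<in> carrier ?F"
      unfolding carrier_free_Abelian_group_iff using keys_cmul[of "e j" "frag_of j"] j by fastforce
    have sF: "?s \<in> carrier ?F" using Cons.IH xs by simp
    have "\<phi> (frag_cmul (e j) (frag_of j) + ?s)
        = \<phi> (frag_cmul (e j) (frag_of j)) \<otimes>\<^bsub>G\<^esub> \<phi> ?s"
      using hom_mult[OF \<phi> jF sF] by simp
    moreover have "frag_cmul (e j) (frag_of j) + ?s \<in> carrier ?F"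
      using monoid.m_closed[OF group.is_monoid[OF group_free_Abelian_group] jF sF] by simp
    ultimately show ?case using Cons.IH xs pow[OF j] by simp
  qed
  from this[of "[1..<Suc k]"] show ?thesis
    unfolding basis_product_def
    by (simp add: sum_list_distinct_conv_sum_set atLeastLessThanSuc_atLeastAtMost del: upt_Suc)
qed

context
  fixes G :: "('a, 'b) monoid_scheme" and N T :: "'a set" and k :: nat and a :: "nat \<Rightarrow> 'a"
  assumes G: "group G" and N: "subgroup N G"
    and basis: "free_abelian_basis G N k a" and T: "right_transversal G N T"
begin

interpretation G: group G by (rule G)

lemma basis_product_closed: "basis_product G k a e \<in> N"
  and basis_product_inj:
    "basis_product G k a e = basis_product G k a e' \<Longrightarrow> j \<in> {1..k} \<Longrightarrow> e j = e' j"
  and basis_product_surj: "x \<in> N \<Longrightarrow> \<exists>e. x = basis_product G k a e"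
  and basis_closed: "i \<in> {1..k} \<Longrightarrow> a i \<in> N"
proof -
  let ?F = "free_Abelian_group {1..k}" and ?N = "G\<lparr>carrier := N\<rparr>"
  let ?s = "\<lambda>e. \<Sum>j\<in>{1..k}. frag_cmul (e j) (frag_of j)"
  from basis obtain \<phi> where \<phi>: "\<phi> \<in> iso ?F ?N" and a: "\<And>i. i \<in> {1..k} \<Longrightarrow> a i = \<phi> (frag_of i)"
    by (auto simp: free_abelian_basis_def)
  then have hom: "\<phi> \<in> hom ?F ?N" and bij: "bij_betw \<phi> (carrier ?F) N"
    by (auto simp: iso_def)
  have eq: "basis_product G k a e = \<phi> (?s e)" for e
    by (rule basis_product_iso[OF G N hom]) (rule a)
  have lookup: "Poly_Mapping.lookup (?s e) i = (if i \<in> {1..k} then e i else 0)" for e i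
    by (simp add: Poly_Mapping.lookup_sum if_distrib[of "(*) _"] cong: if_cong)
  have sF: "?s e \<in> carrier ?F" for e
  proof -
    have "i \<in> {1..k}" if "i \<in> Poly_Mapping.keys (?s e)" for i
      using that lookup[of e i] unfolding in_keys_iff by (metis (full_types))
    then show ?thesis
      unfolding carrier_free_Abelian_group_iff by (rule subsetI)
  qed
  show "basis_product G k a e \<in> N"
    unfolding eq using bij_betwE[OF bij] sF by blast
  show "e j = e' j" if "basis_product G k a e = basis_product G k a e'" "j \<in> {1..k}"
  proof -
    have "?s e = ?s e'"
      using inj_onD[OF bij_betw_imp_inj_on[OF bij] _ sF sF] that(1) unfolding eq by blast
    then show ?thesis using lookup[of e j] lookup[of e' j] that(2) by metis
  qed
  show "\<exists>e. x = basis_product G k a e" if xN: "x \<in> N"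
  proof -
    obtain y where y: "y \<in> carrier ?F" "x = \<phi> y"
      using xN bij_betw_imp_surj_on[OF bij] by blast
    have "y = ?s (Poly_Mapping.lookup y)"
    proof (rule poly_mapping_eqI)
      fix i
      have "i \<notin> {1..k} \<Longrightarrow> Poly_Mapping.lookup y i = 0"
        using y(1) by (auto simp: in_keys_iff)
      then show "Poly_Mapping.lookup y i = Poly_Mapping.lookup (?s (Poly_Mapping.lookup y)) i"
        unfolding lookup by simp
    qed
    then have "x = basis_product G k a (Poly_Mapping.lookup y)"
      unfolding eq using y(2) by (metis (no_types))
    then show ?thesis by blast
  qed
  show "a i \<in> N" if "i \<in> {1..k}"
    unfolding a[OF that] using bij_betwE[OF bij] that by simp
qed

lemma normal_form_ex:
  assumes g: "g \<in> carrier G"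
  shows "\<exists>e. \<exists>t\<in>T. g = basis_product G k a e \<otimes>\<^bsub>G\<^esub> t"
proof -
  have "N #>\<^bsub>G\<^esub> g \<in> rcosets\<^bsub>G\<^esub> N" using G.rcosetsI[OF subgroup.subset[OF N] g] .
  then obtain t where t: "t \<in> T" "t \<in> N #>\<^bsub>G\<^esub> g"
    using T unfolding right_transversal_def by blast
  have tG: "t \<in> carrier G" using T t(1) by (auto simp: right_transversal_def)
  have "g \<in> N #>\<^bsub>G\<^esub> t"
    using G.repr_independence[OF t(2) g N] G.rcos_self[OF g N] by simp
  then obtain x where "x \<in> N" "g = x \<otimes>\<^bsub>G\<^esub> t" by (auto simp: r_coset_def)
  then show ?thesis using basis_product_surj t(1) by blast
qed

lemma normal_form_unique:
  assumes t: "t \<in> T" and t': "t' \<in> T"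
    and eq: "basis_product G k a e \<otimes>\<^bsub>G\<^esub> t = basis_product G k a e' \<otimes>\<^bsub>G\<^esub> t'"
  shows "t = t'" and "\<forall>j\<in>{1..k}. e j = e' j"
proof -
  let ?x = "basis_product G k a e" and ?x' = "basis_product G k a e'"
  have tG: "t \<in> carrier G" "t' \<in> carrier G" using T t t' by (auto simp: right_transversal_def)
  have xN: "?x \<in> N" "?x' \<in> N" using basis_product_closed by auto
  have xG: "?x \<in> carrier G" "?x' \<in> carrier G" using xN subgroup.mem_carrier[OF N] by auto
  have "N #>\<^bsub>G\<^esub> t = N #>\<^bsub>G\<^esub> (?x \<otimes>\<^bsub>G\<^esub> t)" "N #>\<^bsub>G\<^esub> t' = N #>\<^bsub>G\<^esub> (?x' \<otimes>\<^bsub>G\<^esub> t')"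
    using G.repr_independence[OF G.rcosI[OF _ subgroup.subset[OF N]] _ N] xN tG by blast+
  then have "N #>\<^bsub>G\<^esub> t = N #>\<^bsub>G\<^esub> t'" using eq by simp
  then have "t \<in> T \<inter> (N #>\<^bsub>G\<^esub> t)" "t' \<in> T \<inter> (N #>\<^bsub>G\<^esub> t)"
    using t t' G.rcos_self[OF tG(1) N] G.rcos_self[OF tG(2) N] by auto
  moreover have "N #>\<^bsub>G\<^esub> t \<in> rcosets\<^bsub>G\<^esub> N" using G.rcosetsI[OF subgroup.subset[OF N] tG(1)] .
  ultimately show tt: "t = t'" using T unfolding right_transversal_def by blast
  have "?x = ?x'" using eq tt tG xG G.right_cancel by metis
  then show "\<forall>j\<in>{1..k}. e j = e' j" using basis_product_inj by blast
qed

lemma zeta_eq: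
  assumes t: "t \<in> T"
  shows "zeta G k a T (basis_product G k a e \<otimes>\<^bsub>G\<^esub> t) = basis_word G k a e @ [t]"
  unfolding zeta_def
proof (rule the_equality)
  fix w
  assume "\<exists>e'. \<exists>t'\<in>T. basis_product G k a e \<otimes>\<^bsub>G\<^esub> t = basis_product G k a e' \<otimes>\<^bsub>G\<^esub> t'
    \<and> w = basis_word G k a e' @ [t']"
  then obtain e' t' where t': "t' \<in> T" and w: "w = basis_word G k a e' @ [t']"
    and eq: "basis_product G k a e \<otimes>\<^bsub>G\<^esub> t = basis_product G k a e' \<otimes>\<^bsub>G\<^esub> t'" by blast
  have "basis_word G k a e = basis_word G k a e'"
    unfolding basis_word_def
    by (rule arg_cong[of _ _ concat], rule map_cong)
      (use normal_form_unique(2)[OF t t' eq] in \<open>auto simp: Suc_le_eq less_Suc_eq_le simp del: upt_Suc\<close>)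
  then show "w = basis_word G k a e @ [t]"
    using w normal_form_unique(1)[OF t t' eq] by simp
qed (use t in blast)

lemma zeta_lists:
  assumes "g \<in> carrier G"
  shows "zeta G k a T g \<in> lists (signed_basis G k a \<union> T)"
proof -
  obtain e t where t: "t \<in> T" "g = basis_product G k a e \<otimes>\<^bsub>G\<^esub> t"
    using normal_form_ex[OF assms] by blast
  have "set (power_word G (a j) m) \<subseteq> signed_basis G k a" if "j \<in> {1..k}" for j m
    using that by (auto simp: power_word_def signed_basis_def)
  then have "set (basis_word G k a e) \<subseteq> signed_basis G k a"
    unfolding basis_word_def by (force simp del: upt_Suc One_nat_def)
  then show ?thesis using zeta_eq[OF t(1)] t by auto
qed

lemma eval_zeta:
  assumes "g \<in> carrier G"
  shows "eval_word G (\<lambda>x. x) (zeta G k a T g) = g"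
proof -
  obtain e t where t: "t \<in> T" "g = basis_product G k a e \<otimes>\<^bsub>G\<^esub> t"
    using normal_form_ex[OF assms] by blast
  have tG: "t \<in> carrier G" using T t(1) by (auto simp: right_transversal_def)
  note eval = eval_word_append[OF G.monoid_axioms, of "\<lambda>x. x" "carrier G"]
  have aG: "a j \<in> carrier G" if "j \<in> {1..k}" for j
    using basis_closed[OF that] subgroup.mem_carrier[OF N] by blast
  have rep: "eval_word G (\<lambda>x. x) (replicate n x) = x [^]\<^bsub>G\<^esub> n" if "x \<in> carrier G" for x n
    using that by (induction n) (simp_all add: eval_word_def G.nat_pow_Suc2[symmetric] del: nat_pow_Suc)
  have pw: "eval_word G (\<lambda>x. x) (power_word G x m) = x [^]\<^bsub>G\<^esub> m" if x: "x \<in> carrier G" for x m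
  proof (cases "m \<ge> 0")
    case True
    then show ?thesis using rep[OF x] pow_nat[OF True, of G x] by (simp add: power_word_def)
  next
    case False
    have "inv\<^bsub>G\<^esub> x [^]\<^bsub>G\<^esub> nat (- m) = inv\<^bsub>G\<^esub> x [^]\<^bsub>G\<^esub> (- m)"
      using pow_nat[of "- m" G "inv\<^bsub>G\<^esub> x"] False by simp
    also have "\<dots> = x [^]\<^bsub>G\<^esub> m"
      using G.int_pow_inv[OF x, of "- m"] G.int_pow_neg[OF x, of m] x by simp
    finally show ?thesis
      using rep[of "inv\<^bsub>G\<^esub> x" "nat (- m)"] x False by (simp add: power_word_def)
  qed
  have pwl: "power_word G x m \<in> lists (carrier G)" if "x \<in> carrier G" for x m
    using that by (auto simp: power_word_def in_lists_conv_set)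
  have "eval_word G (\<lambda>x. x) (concat (map (\<lambda>j. power_word G (a j) (e j)) xs))
      = foldr (\<otimes>\<^bsub>G\<^esub>) (map (\<lambda>j. a j [^]\<^bsub>G\<^esub> e j) xs) \<one>\<^bsub>G\<^esub>
    \<and> concat (map (\<lambda>j. power_word G (a j) (e j)) xs) \<in> lists (carrier G)"
    if "set xs \<subseteq> {1..k}" for xs
    using that
  proof (induction xs)
    case Nil
    then show ?case by (simp add: eval_word_def)
  next
    case (Cons j xs)
    have j: "a j \<in> carrier G" using Cons.prems aG by simp
    note p = pwl[OF j, of "e j"]
    show ?case using Cons pw[OF j, of "e j"] p eval(2)[OF _ p] by simp
  qed
  from this[of "[1..<Suc k]"] have "eval_word G (\<lambda>x. x) (basis_word G k a e) = basis_product G k a e"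
    "basis_word G k a e \<in> lists (carrier G)"
    unfolding basis_word_def basis_product_def
    by (simp_all add: atLeastLessThanSuc_atLeastAtMost del: upt_Suc)
  then show ?thesis
    using zeta_eq[OF t(1), of e] t(2) tG eval(2)[of "basis_word G k a e" "[t]"]
    by (simp add: eval_word_def)
qed

end

end

theory Submission
  imports Defs "HOL-Library.Multiset" "HOL-Library.Disjoint_Sets"
begin

text \<open>
  A solution assigns to each unknown \<open>X\<^sub>i\<close> an element \<open>a\<^sub>1\<^bsup>e(i,1)\<^esup> \<dots> a\<^sub>k\<^bsup>e(i,k)\<^esup> t\<^sub>i\<close> with \<open>t\<^sub>i \<in> T\<close>, and
  its word has length \<open>\<Sum>|e(i,j)| + n + (n - 1)\<close>. The transversal \<open>T\<close> is finite, so the language is a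
  finite union, over the tuples \<open>t\<close>, of sets of words that correspond to exponent vectors \<open>e\<close>; the
  union is disjoint and the correspondence injective because normal forms are unique. It remains to
  count, for a fixed tuple \<open>t\<close>, the admissible exponent vectors by their \<open>\<ell>\<^sub>1\<close> norm.

  Two facts carry the proof. The first is that the admissible exponents for fixed \<open>t\<close> form an affine
  set in \<open>\<int>\<^bsup>nk\<^esup>\<close>, that is, they are closed under \<open>x - y + z\<close> (\<open>affine_solution_exponents\<close>). Changing
  exponents moves the value of \<open>X\<^sub>i\<close> inside the coset \<open>N t\<^sub>i\<close>, and the quadruples \<open>(p, q, r, s)\<close> in a
  common coset of \<open>N\<close> with \<open>s = p q\<^sup>-\<^sup>1 r\<close> form a subgroup of \<open>G\<^sup>4\<close> as \<open>N\<close> is abelian and normal. So if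
  the unknowns take values in such quadruples, then so does every element of \<open>G * F\<close>. Where the
  first three entries are trivial, the fourth is trivial too.

  The second fact is that an affine set of integer vectors has a rational generating function with
  respect to the \<open>\<ell>\<^sub>1\<close> norm (\<open>rational_counting_series_affine\<close>). Splitting vectors into positive and
  negative parts turns them into multisets over a finite set, weighted by size, and
  \<open>rational_counting_series_convex\<close> counts these by the induction that proves the Hilbert--Serre
  theorem. For a translation \<open>g\<close>, the series of a set is obtained, after multiplication by
  \<open>1 - X\<^bsup>|g|\<^esup>\<close>, from those of the kernel and the cokernel of \<open>g\<close>, on which \<open>g\<close> acts trivially. Finitely
  many translations have to be treated, by Dickson's lemma. When all of them act trivially, the set
  is an antichain, and Dickson's lemma shows that it is finite.
\<close>

section \<open>Rational power series\<close>

lemma rational_fps_of_poly: "rational_fps (fps_of_poly p)"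
  unfolding rational_fps_def by (rule exI[of _ p], rule exI[of _ 1]) simp

lemma rational_fps_add:
  assumes "rational_fps f" "rational_fps g"
  shows "rational_fps (f + g)"
proof -
  obtain p q r s where "q \<noteq> 0" "fps_of_poly q * f = fps_of_poly p"
    and "s \<noteq> 0" "fps_of_poly s * g = fps_of_poly r"
    using assms by (auto simp: rational_fps_def)
  moreover have "fps_of_poly (q * s) * (f + g)
      = fps_of_poly s * (fps_of_poly q * f) + fps_of_poly q * (fps_of_poly s * g)"
    by (simp add: fps_of_poly_mult algebra_simps)
  ultimately have "q * s \<noteq> 0 \<and> fps_of_poly (q * s) * (f + g) = fps_of_poly (s * p + q * r)"
    by (simp add: fps_of_poly_mult fps_of_poly_add)
  then show ?thesis unfolding rational_fps_def by blast
qed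

lemma rational_fps_poly_mult:
  assumes "rational_fps f"
  shows "rational_fps (fps_of_poly r * f)"
proof -
  obtain p q where "q \<noteq> 0" "fps_of_poly q * f = fps_of_poly p"
    using assms by (auto simp: rational_fps_def)
  then have "fps_of_poly q * (fps_of_poly r * f) = fps_of_poly (r * p)"
    by (simp add: fps_of_poly_mult mult.left_commute)
  then show ?thesis using \<open>q \<noteq> 0\<close> unfolding rational_fps_def by blast
qed

lemma rational_fps_poly_cancel:
  assumes "rational_fps (fps_of_poly r * f)" "r \<noteq> 0"
  shows "rational_fps f"
proof -
  obtain p q where "q \<noteq> 0" "fps_of_poly q * (fps_of_poly r * f) = fps_of_poly p"
    using assms by (auto simp: rational_fps_def)
  then have "q * r \<noteq> 0 \<and> fps_of_poly (q * r) * f = fps_of_poly p"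
    using assms(2) by (simp add: fps_of_poly_mult mult.assoc)
  then show ?thesis unfolding rational_fps_def by blast
qed

lemma rational_fps_diff:
  assumes "rational_fps f" "rational_fps g"
  shows "rational_fps (f - g)"
  using rational_fps_add[OF assms(1) rational_fps_poly_mult[OF assms(2), of "- 1"]]
  by (simp add: fps_of_poly_uminus)

lemma rational_fps_X_power_mult:
  assumes "rational_fps f"
  shows "rational_fps (fps_X ^ c * f)"
  using rational_fps_poly_mult[OF assms, of "monom 1 c"] by (simp add: fps_of_poly_monom')

lemma rational_fps_one_minus_X_power_cancel:
  assumes "rational_fps ((1 - fps_X ^ c) * f)" "c > 0"
  shows "rational_fps f"
proof (rule rational_fps_poly_cancel)
  show "rational_fps (fps_of_poly (1 - monom 1 c) * f)"
    using assms(1) by (simp add: fps_of_poly_diff fps_of_poly_monom')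
  \<comment> \<open>For \<open>c = 0\<close> the factor would be zero.\<close>
  have "poly.coeff (1 - monom 1 c :: rat poly) 0 = 1"
    using assms(2) by simp
  then show "(1 - monom 1 c :: rat poly) \<noteq> 0" by fastforce
qed


section \<open>Counting by weight\<close>

definition counting_series :: "('x \<Rightarrow> nat) \<Rightarrow> 'x set \<Rightarrow> rat fps" where
  "counting_series \<omega> A = Abs_fps (\<lambda>m. of_nat (card {x \<in> A. \<omega> x = m}))"

lemma counting_series_Un_disjoint:
  assumes "A \<inter> B = {}" "\<And>m. finite {x \<in> A \<union> B. \<omega> x = m}"
  shows "counting_series \<omega> (A \<union> B) = counting_series \<omega> A + counting_series \<omega> B"
proof (rule fps_ext)
  fix m
  have "{x \<in> A \<union> B. \<omega> x = m} = {x \<in> A. \<omega> x = m} \<union> {x \<in> B. \<omega> x = m}" by blast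
  moreover from this have "finite {x \<in> A. \<omega> x = m}" "finite {x \<in> B. \<omega> x = m}"
    using assms(2)[of m] by simp_all
  ultimately have "card {x \<in> A \<union> B. \<omega> x = m} = card {x \<in> A. \<omega> x = m} + card {x \<in> B. \<omega> x = m}"
    using assms(1) by (simp add: card_Un_disjoint disjoint_iff)
  then show "fps_nth (counting_series \<omega> (A \<union> B)) m = fps_nth (counting_series \<omega> A + counting_series \<omega> B) m"
    by (simp add: counting_series_def)
qed

lemma counting_series_image:
  assumes inj: "inj_on f A" and \<omega>: "\<And>x. x \<in> A \<Longrightarrow> \<omega> (f x) = c + \<omega>' x"
  shows "counting_series \<omega> (f ` A) = fps_X ^ c * counting_series \<omega>' A"
proof (rule fps_ext)
  fix m
  have "{y \<in> f ` A. \<omega> y = m} = f ` {x \<in> A. c + \<omega>' x = m}"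
    using \<omega> by auto
  then have "card {y \<in> f ` A. \<omega> y = m} = card {x \<in> A. c + \<omega>' x = m}"
    using card_image[OF inj_on_subset[OF inj, of "{x \<in> A. c + \<omega>' x = m}"]] by simp
  also have "{x \<in> A. c + \<omega>' x = m} = (if m < c then {} else {x \<in> A. \<omega>' x = m - c})"
    by auto
  finally show "fps_nth (counting_series \<omega> (f ` A)) m = fps_nth (fps_X ^ c * counting_series \<omega>' A) m"
    by (simp add: counting_series_def fps_X_power_mult_nth)
qed

lemma rational_counting_series_finite:
  assumes "finite A"
  shows "rational_fps (counting_series \<omega> A)"
proof -
  have "counting_series \<omega> A = fps_of_poly (\<Sum>x\<in>A. monom 1 (\<omega> x))"
    using assms by (intro fps_ext) (simp add: counting_series_def coeff_sum sum.If_cases Int_def)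
  then show ?thesis using rational_fps_of_poly by simp
qed

lemma rational_counting_series_UN_disjoint:
  assumes "finite S" "\<And>t. t \<in> S \<Longrightarrow> rational_fps (counting_series \<omega> (A t))"
    and "disjoint_family_on A S" "\<And>t m. t \<in> S \<Longrightarrow> finite {x \<in> A t. \<omega> x = m}"
  shows "rational_fps (counting_series \<omega> (\<Union>t\<in>S. A t))"
  using assms
proof (induction S)
  case empty
  then show ?case by (simp add: rational_counting_series_finite)
next
  case (insert t S)
  have "{x \<in> \<Union> (A ` insert t S). \<omega> x = m} = (\<Union>s\<in>insert t S. {x \<in> A s. \<omega> x = m})" for m
    by blast
  then have "finite {x \<in> A t \<union> \<Union> (A ` S). \<omega> x = m}" for m
    using insert.hyps(1) insert.prems(3) by simp
  moreover have "A t \<inter> \<Union> (A ` S) = {}" "disjoint_family_on A S"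
    using insert.prems(2) insert.hyps(2) by (auto simp: disjoint_family_on_def)
  ultimately show ?case
    using insert by (simp add: counting_series_Un_disjoint rational_fps_add)
qed


section \<open>Dickson's lemma\<close>

text \<open>For finitely many coordinates an increasing subsequence is extracted one coordinate at a time.
An injective sequence from an infinite antichain of multisets would thus contain two comparable
terms, so antichains are finite.\<close>

lemma nat_incseq_subsequence:
  fixes u :: "nat \<Rightarrow> nat"
  obtains f where "strict_mono f" "incseq (u \<circ> f)"
proof -
  obtain f where f: "strict_mono f" "monoseq (\<lambda>n. u (f n))"
    using seq_monosub[of u] by blast
  show thesis
  proof (cases "incseq (\<lambda>n. u (f n))")
    case True
    then show ?thesis using that f by (simp add: comp_def)
  next
    case False
    then have dec: "decseq (\<lambda>n. u (f n))" using f(2) by (simp add: monoseq_iff)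
    \<comment> \<open>A decreasing sequence of natural numbers is constant from where it takes its minimum.\<close>
    obtain N where N: "\<And>n. u (f N) \<le> u (f n)"
      using ex_has_least_nat[of "\<lambda>_. True" 0 "\<lambda>n. u (f n)"] by auto
    have "u (f (N + n)) = u (f N)" for n
      using N[of "N + n"] decseqD[OF dec, of N "N + n"] by simp
    then have "incseq (u \<circ> (\<lambda>n. f (N + n)))"
      by (simp add: incseq_def)
    moreover have "strict_mono (\<lambda>n. f (N + n))"
      using f(1) by (simp add: strict_mono_def)
    ultimately show ?thesis using that by blast
  qed
qed

lemma mset_incseq_subsequence:
  fixes s :: "nat \<Rightarrow> 'j multiset"
  assumes "finite J"
  shows "\<exists>f. strict_mono f \<and> (\<forall>j\<in>J. incseq (\<lambda>n. count (s (f n)) j))"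
  using assms
proof (induction J)
  case empty
  then show ?case using strict_mono_id by blast
next
  case (insert j J)
  then obtain f where f: "strict_mono f" "\<forall>j\<in>J. incseq (\<lambda>n. count (s (f n)) j)" by blast
  obtain g where g: "strict_mono g" "incseq ((\<lambda>n. count (s (f n)) j) \<circ> g)"
    by (rule nat_incseq_subsequence)
  have "strict_mono (f \<circ> g)" using f g by (simp add: strict_mono_o)
  moreover have "incseq (\<lambda>n. count (s ((f \<circ> g) n)) i)" if "i \<in> insert j J" for i
    using that f(2) g by (auto simp: incseq_def strict_mono_less_eq)
  ultimately show ?case by blast
qed

lemma finite_mset_antichain:
  fixes A :: "'j multiset set"
  assumes J: "finite J" and AJ: "\<And>x. x \<in> A \<Longrightarrow> set_mset x \<subseteq> J"
    and anti: "\<And>x y. x \<in> A \<Longrightarrow> y \<in> A \<Longrightarrow> x \<subseteq># y \<Longrightarrow> x = y"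
  shows "finite A"
proof (rule ccontr)
  assume "infinite A"
  then obtain s :: "nat \<Rightarrow> 'j multiset" where s: "inj s" "range s \<subseteq> A"
    using infinite_countable_subset by blast
  obtain f where f: "strict_mono f" "\<And>j. j \<in> J \<Longrightarrow> incseq (\<lambda>n. count (s (f n)) j)"
    using mset_incseq_subsequence[OF J] by blast
  have sA: "s n \<in> A" for n using s(2) by blast
  have "count (s (f 0)) j \<le> count (s (f 1)) j" for j
  proof (cases "j \<in> J")
    case True
    then show ?thesis using f(2) by (simp add: incseq_def)
  next
    case False
    then have "count (s (f 0)) j = 0" using AJ[OF sA] by (meson count_inI in_mono)
    then show ?thesis by simp
  qed
  then have "s (f 0) = s (f 1)"
    using anti[OF sA sA] by (simp add: subseteq_mset_def)
  then show False
    using s(1) f(1) by (auto dest!: injD simp: strict_mono_eq)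
qed


section \<open>Sets of multisets convex along a set of translations\<close>

lemma finite_multisets_size:
  assumes "finite J"
  shows "finite {x. set_mset x \<subseteq> J \<and> size x = m}"
proof (rule finite_subset)
  show "{x. set_mset x \<subseteq> J \<and> size x = m} \<subseteq> mset ` {xs. set xs \<subseteq> J \<and> length xs = m}"
  proof
    fix x assume x: "x \<in> {x. set_mset x \<subseteq> J \<and> size x = m}"
    obtain xs where "mset xs = x" using ex_mset by blast
    then show "x \<in> mset ` {xs. set xs \<subseteq> J \<and> length xs = m}"
      using x by (intro image_eqI[of _ _ xs]) auto
  qed
qed (use finite_lists_length_eq[OF assms] in simp)

text \<open>Multisets over a finite set \<open>J\<close> are the vectors in \<open>\<nat>\<^sup>J\<close>, and \<open>size\<close> is the sum of the
coordinates. Think of \<open>M\<close> as the nonnegative solutions of a homogeneous linear system and of \<open>D\<close>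
as solutions of a corresponding inhomogeneous one. The condition says that a walk from a point of
\<open>D\<close> back to \<open>D\<close> by two translations from \<open>M\<close> does not leave \<open>D\<close> on the way. The whole solution
set has this property, and so do the differences of two sets that are closed under translation by
\<open>M\<close>; these play the role of subquotients of a module over the monoid ring of \<open>M\<close>.\<close>

definition convex_along :: "'j multiset set \<Rightarrow> 'j multiset set \<Rightarrow> bool" where
  "convex_along M D \<longleftrightarrow>
     (\<forall>x\<in>D. \<forall>m\<in>M. \<forall>m'\<in>M. x + m + m' \<in> D \<longrightarrow> x + m \<in> D)"

lemma convex_alongD:
  "convex_along M D \<Longrightarrow> x \<in> D \<Longrightarrow> m \<in> M \<Longrightarrow> m' \<in> M \<Longrightarrow> x + m + m' \<in> D \<Longrightarrow> x + m \<in> D"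
  unfolding convex_along_def by blast

text \<open>Translation by \<open>g\<close> acts on \<open>D\<close> as a partial injection. In the module picture, where points outside
\<open>D\<close> are zero, the points that it moves out of \<open>D\<close> span its kernel, and the points of \<open>D\<close> that are
not reached represent its cokernel. Convexity survives in both, and on both of them translation by
\<open>g\<close> has become zero.\<close>

lemma convex_along_kernel:
  assumes D: "convex_along M D" and g: "g \<in> M"
  shows "convex_along M {x \<in> D. x + g \<notin> D}"
  unfolding convex_along_def
proof (intro ballI impI)
  fix x m m'
  assume x: "x \<in> {x \<in> D. x + g \<notin> D}" and m: "m \<in> M" "m' \<in> M"
    and e: "x + m + m' \<in> {x \<in> D. x + g \<notin> D}"
  have "x + m \<in> D" using convex_alongD[OF D _ m] x e by blast
  moreover have "x + m + g \<notin> D"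
  proof
    assume "x + m + g \<in> D"
    then have "x + g + m \<in> D" by (simp add: ac_simps)
    then show False using convex_alongD[OF D _ g m(1)] x by blast
  qed
  ultimately show "x + m \<in> {x \<in> D. x + g \<notin> D}" by blast
qed

lemma convex_along_cokernel:
  assumes D: "convex_along M D" and g: "g \<in> M"
  shows "convex_along M (D - (\<lambda>x. x + g) ` D)"
  unfolding convex_along_def
proof (intro ballI impI)
  fix x m m'
  assume x: "x \<in> D - (\<lambda>x. x + g) ` D" and m: "m \<in> M" "m' \<in> M"
    and e: "x + m + m' \<in> D - (\<lambda>x. x + g) ` D"
  have "x + m \<in> D" using convex_alongD[OF D _ m] x e by blast
  moreover have "x + m \<notin> (\<lambda>x. x + g) ` D"
  proof
    assume "x + m \<in> (\<lambda>x. x + g) ` D"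
    then obtain y where y: "y \<in> D" "x + m = y + g" by blast
    then have eq: "x + m + m' = y + m' + g" by (simp add: ac_simps)
    then have "y + m' \<in> D" using convex_alongD[OF D y(1) m(2) g] e unfolding eq by blast
    then show False using eq e by blast
  qed
  ultimately show "x + m \<in> D - (\<lambda>x. x + g) ` D" by blast
qed

text \<open>The points that translation by \<open>g\<close> keeps in \<open>D\<close> are \<open>D\<close> without the kernel, and their translates
are \<open>D\<close> without the complementary cokernel. Counting \<open>D\<close> in both ways and eliminating the series
of the points kept gives the formula, which is additivity of Hilbert series along
\<open>0 \<rightarrow> K \<rightarrow> D \<rightarrow> D \<rightarrow> C \<rightarrow> 0\<close>.\<close>

lemma counting_series_kernel_cokernel:
  fixes D :: "'j multiset set"
  assumes fin: "\<And>m. finite {x \<in> D. size x = m}"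
  shows "(1 - fps_X ^ size g) * counting_series size D
    = counting_series size (D - (\<lambda>x. x + g) ` D)
      - fps_X ^ size g * counting_series size {x \<in> D. x + g \<notin> D}"
proof -
  let ?K = "{x \<in> D. x + g \<notin> D}" and ?C = "D - (\<lambda>x. x + g) ` D"
  let ?S = "{x \<in> D. x + g \<in> D}"
  have "?K \<union> ?S = D" "?K \<inter> ?S = {}" by auto
  then have 1: "counting_series size D = counting_series size ?K + counting_series size ?S"
    using counting_series_Un_disjoint[of ?K ?S size] fin by simp
  have "?C \<union> (\<lambda>x. x + g) ` ?S = D" "?C \<inter> (\<lambda>x. x + g) ` ?S = {}" by auto
  then have "counting_series size D
      = counting_series size ?C + counting_series size ((\<lambda>x. x + g) ` ?S)"
    using counting_series_Un_disjoint[of ?C "(\<lambda>x. x + g) ` ?S" size] fin by simp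
  also have "counting_series size ((\<lambda>x. x + g) ` ?S) = fps_X ^ size g * counting_series size ?S"
    by (rule counting_series_image) (auto simp: inj_on_def)
  finally have 2: "counting_series size D
      = counting_series size ?C + fps_X ^ size g * counting_series size ?S" .
  have "(1 - fps_X ^ size g) * counting_series size D
      = counting_series size D - fps_X ^ size g * counting_series size D"
    by (simp add: left_diff_distrib)
  also have "\<dots> = (counting_series size ?C + fps_X ^ size g * counting_series size ?S)
      - fps_X ^ size g * (counting_series size ?K + counting_series size ?S)"
    using 1 2 by metis
  finally show ?thesis by (simp add: distrib_left)
qed

text \<open>When \<open>M\<close> is a submonoid closed under differences, its minimal nonempty elements form the Hilbert basis of \<open>M\<close>;
Dickson's lemma makes it finite.\<close>

definition minimal_nonempty :: "'j multiset set \<Rightarrow> 'j multiset set" where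
  "minimal_nonempty M = {g \<in> M. g \<noteq> {#} \<and> (\<forall>h\<in>M. h \<noteq> {#} \<longrightarrow> h \<subseteq># g \<longrightarrow> h = g)}"

lemma minimal_nonempty_below:
  assumes "m \<in> M" "m \<noteq> {#}"
  obtains g where "g \<in> minimal_nonempty M" "g \<subseteq># m"
proof -
  obtain g where g: "g \<in> M" "g \<noteq> {#}" "g \<subseteq># m"
    and least: "\<And>h. h \<in> M \<Longrightarrow> h \<noteq> {#} \<Longrightarrow> h \<subseteq># m \<Longrightarrow> size g \<le> size h"
    using ex_has_least_nat[of "\<lambda>h. h \<in> M \<and> h \<noteq> {#} \<and> h \<subseteq># m" m size] assms by auto
  have "h = g" if "h \<in> M" "h \<noteq> {#}" "h \<subseteq># g" for h
  proof (rule ccontr)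
    assume "h \<noteq> g"
    then have "size h < size g" using that(3) by (simp add: mset_subset_size subset_mset.less_le)
    then show False using least[OF that(1,2)] that(3) g(3) subset_mset.order_trans by fastforce
  qed
  then show thesis using that g unfolding minimal_nonempty_def by blast
qed

lemma finite_minimal_nonempty:
  assumes "finite J" "\<And>m. m \<in> M \<Longrightarrow> set_mset m \<subseteq> J"
  shows "finite (minimal_nonempty M)"
  by (rule finite_mset_antichain[OF assms(1)]) (use assms(2) in \<open>auto simp: minimal_nonempty_def\<close>)

text \<open>This is the Hilbert--Serre argument. If translation by a basis element \<open>g\<close> maps some point of \<open>D\<close>
into \<open>D\<close>, then \<open>(1 - X\<^bsup>|g|\<^esup>)\<close> times the series of \<open>D\<close> is a combination of the series of the kernel
and the cokernel of \<open>g\<close>, on which fewer basis elements act nontrivially. If no basis element acts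
nontrivially, then \<open>D\<close> is an antichain by convexity: a chain \<open>x \<subset> y\<close> in \<open>D\<close> could be refined by a
first step along a basis element. So \<open>D\<close> is finite by Dickson's lemma.\<close>

theorem rational_counting_series_convex:
  fixes D M :: "'j multiset set"
  assumes J: "finite J" and MJ: "\<And>m. m \<in> M \<Longrightarrow> set_mset m \<subseteq> J"
    and M: "\<And>g m. g \<in> M \<Longrightarrow> m \<in> M \<Longrightarrow> g \<subseteq># m \<Longrightarrow> m - g \<in> M"
    and DJ: "\<And>x. x \<in> D \<Longrightarrow> set_mset x \<subseteq> J"
    and DM: "\<And>x y. x \<in> D \<Longrightarrow> y \<in> D \<Longrightarrow> x \<subseteq># y \<Longrightarrow> y - x \<in> M"
    and conv: "convex_along M D"
  shows "rational_fps (counting_series size D)"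
proof -
  note finB = finite_minimal_nonempty[OF J MJ]
  show ?thesis
    using DJ DM conv
  proof (induction "card {g \<in> minimal_nonempty M. \<exists>x\<in>D. x + g \<in> D}" arbitrary: D rule: less_induct)
    case (less D)
    have fin: "finite {x \<in> D. size x = m}" for m
      using less.prems(1) by (auto intro: finite_subset[OF _ finite_multisets_size[OF J, of m]])
    show ?case
    proof (cases "\<exists>g\<in>minimal_nonempty M. \<exists>x\<in>D. x + g \<in> D")
      case False
      have "x = y" if xy: "x \<in> D" "y \<in> D" "x \<subseteq># y" for x y
      proof (rule ccontr)
        assume "x \<noteq> y"
        then have "y - x \<noteq> {#}" using xy(3) by (metis add.right_neutral subset_mset.add_diff_inverse)
        then obtain g where g: "g \<in> minimal_nonempty M" "g \<subseteq># y - x"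
          using minimal_nonempty_below less.prems(2)[OF xy] by blast
        then have gM: "g \<in> M" by (simp add: minimal_nonempty_def)
        have "x + g + (y - x - g) = y"
          using g(2) xy(3) subset_mset.add_diff_inverse[of g "y - x"]
            subset_mset.add_diff_inverse[of x y] by (simp only: add.assoc)
        then have "x + g \<in> D"
          using convex_alongD[OF less.prems(3) xy(1) gM M[OF gM less.prems(2)[OF xy] g(2)]] xy(2)
          by simp
        then show False using False g(1) xy(1) by blast
      qed
      then have "finite D" using finite_mset_antichain[OF J] less.prems(1) by blast
      then show ?thesis by (rule rational_counting_series_finite)
    next
      case True
      then obtain g where g: "g \<in> minimal_nonempty M" "\<exists>x\<in>D. x + g \<in> D" by blast
      then have gM: "g \<in> M" and size: "size g > 0"
        by (auto simp: minimal_nonempty_def nonempty_has_size)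
      \<comment> \<open>Subsets of \<open>D\<close> gain no acting basis elements, and they lose \<open>g\<close> if it acts trivially on them.\<close>
      have smaller: "rational_fps (counting_series size D')"
        if D': "D' \<subseteq> D" "convex_along M D'" "\<And>x. x \<in> D' \<Longrightarrow> x + g \<notin> D'" for D'
      proof (rule less.hyps)
        have "{g \<in> minimal_nonempty M. \<exists>x\<in>D'. x + g \<in> D'}
            \<subset> {g \<in> minimal_nonempty M. \<exists>x\<in>D. x + g \<in> D}"
          using D' g by blast
        then show "card {g \<in> minimal_nonempty M. \<exists>x\<in>D'. x + g \<in> D'}
            < card {g \<in> minimal_nonempty M. \<exists>x\<in>D. x + g \<in> D}"
          using finB by (intro psubset_card_mono) simp_all
      qed (use D' less.prems in \<open>blast+\<close>)
      have "rational_fps (counting_series size (D - (\<lambda>x. x + g) ` D))"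
        by (rule smaller) (use convex_along_cokernel[OF less.prems(3) gM] in auto)
      moreover have "rational_fps (counting_series size {x \<in> D. x + g \<notin> D})"
        by (rule smaller) (use convex_along_kernel[OF less.prems(3) gM] in auto)
      ultimately have "rational_fps ((1 - fps_X ^ size g) * counting_series size D)"
        unfolding counting_series_kernel_cokernel[OF fin]
        by (intro rational_fps_diff rational_fps_X_power_mult)
      then show ?thesis using size by (rule rational_fps_one_minus_X_power_cancel)
    qed
  qed
qed


section \<open>Affine sets of integer vectors\<close>

text \<open>For nonempty \<open>E\<close> this means that \<open>E\<close> is a coset of a subgroup. The ternary form treats the empty
set on the same footing and can be checked without naming the subgroup.\<close>

definition affine_int_set :: "('i \<Rightarrow> int) set \<Rightarrow> bool" where
  "affine_int_set E \<longleftrightarrow> (\<forall>x\<in>E. \<forall>y\<in>E. \<forall>z\<in>E. (\<lambda>i. x i - y i + z i) \<in> E)"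

definition l1_norm :: "'i set \<Rightarrow> ('i \<Rightarrow> int) \<Rightarrow> nat" where
  "l1_norm I e = (\<Sum>i\<in>I. nat \<bar>e i\<bar>)"

text \<open>An integer vector is encoded by its positive and negative parts: the letter \<open>(i, True)\<close> adds \<open>1\<close> to
the coordinate \<open>i\<close>, and \<open>(i, False)\<close> subtracts \<open>1\<close>. The encoding is unique when no coordinate has
letters of both kinds, and then the size of the multiset is the \<open>\<ell>\<^sub>1\<close> norm of the vector.\<close>

definition signed_count :: "('i \<times> bool) multiset \<Rightarrow> 'i \<Rightarrow> int" where
  "signed_count x i = int (count x (i, True)) - int (count x (i, False))"

definition reduced :: "('i \<times> bool) multiset \<Rightarrow> bool" where
  "reduced x \<longleftrightarrow> (\<forall>i. count x (i, True) = 0 \<or> count x (i, False) = 0)"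

lemma reduced_count:
  assumes "reduced x"
  shows "count x (i, True) = nat (signed_count x i)" "count x (i, False) = nat (- signed_count x i)"
  using assms[unfolded reduced_def, rule_format, of i] by (auto simp: signed_count_def)

lemma size_reduced:
  assumes x: "reduced x" and I: "finite I" "set_mset x \<subseteq> I \<times> UNIV"
  shows "size x = l1_norm I (signed_count x)"
proof -
  have "size x = (\<Sum>c\<in>I \<times> UNIV. count x c)"
    unfolding size_multiset_overloaded_eq
    by (rule sum.mono_neutral_left) (use I in \<open>auto simp: not_in_iff\<close>)
  also have "\<dots> = (\<Sum>i\<in>I. count x (i, True) + count x (i, False))"
    by (simp add: sum.cartesian_product' UNIV_bool add.commute)
  also have "\<dots> = l1_norm I (signed_count x)"
    unfolding l1_norm_def by (rule sum.cong) (auto simp: reduced_count[OF x])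
  finally show ?thesis .
qed

lemma reduced_ex:
  fixes e :: "'i \<Rightarrow> int"
  assumes I: "finite I" and e: "\<And>i. i \<notin> I \<Longrightarrow> e i = 0"
  obtains x where "reduced x" "set_mset x \<subseteq> I \<times> UNIV" "signed_count x = e"
proof -
  define x where "x = (\<Sum>i\<in>I. replicate_mset (nat (e i)) (i, True)
    + replicate_mset (nat (- e i)) (i, False))"
  have "count x (i, b) = (if i \<in> I then nat (if b then e i else - e i) else 0)" for i b
    unfolding x_def using I by (simp add: count_sum)
  then have count: "count x (i, b) = nat (if b then e i else - e i)" for i b
    using e[of i] by simp
  have "set_mset x \<subseteq> I \<times> UNIV"
  proof
    fix c assume "c \<in># x"
    then show "c \<in> I \<times> UNIV" using e[of "fst c"] count[of "fst c" "snd c"]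
      by (cases c) (auto simp flip: count_greater_zero_iff split: if_splits)
  qed
  moreover have "reduced x" "signed_count x = e"
    by (auto simp: reduced_def signed_count_def count fun_eq_iff)
  ultimately show thesis using that by blast
qed

text \<open>The reduced encodings of the vectors in \<open>E\<close> form a set \<open>D\<close> of multisets that is convex along the
encodings \<open>M\<close> of the vectors that translate \<open>E\<close> into itself: affine relations pass from \<open>x\<close> to
\<open>x + m\<close>, and being reduced passes from \<open>x + m + m'\<close> down to \<open>x + m\<close>. Hence all orthants are
treated at once.\<close>

theorem rational_counting_series_affine:
  fixes E :: "('i \<Rightarrow> int) set"
  assumes I: "finite I" and supp: "\<And>e i. e \<in> E \<Longrightarrow> i \<notin> I \<Longrightarrow> e i = 0"
    and E: "affine_int_set E"
  shows "rational_fps (counting_series (l1_norm I) E)"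
proof -
  define D where "D = {x. set_mset x \<subseteq> I \<times> UNIV \<and> reduced x \<and> signed_count x \<in> E}"
  define M where "M = {m. set_mset m \<subseteq> I \<times> UNIV \<and> (\<forall>e\<in>E. (\<lambda>i. e i + signed_count m i) \<in> E)}"
  have aff: "(\<lambda>i. x i - y i + z i) \<in> E" if "x \<in> E" "y \<in> E" "z \<in> E" for x y z
    using E that unfolding affine_int_set_def by blast
  have sc_add: "signed_count (x + y) i = signed_count x i + signed_count y i" for x y :: "('i \<times> bool) multiset" and i
    by (simp add: signed_count_def)
  have sc_diff: "signed_count (y - x) i = signed_count y i - signed_count x i" if "x \<subseteq># y"
    for x y :: "('i \<times> bool) multiset" and i
    using sc_add[of x "y - x" i] that by simp
  have "rational_fps (counting_series size D)"
  proof (rule rational_counting_series_convex)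
    show "finite (I \<times> (UNIV :: bool set))" using I by simp
    show "m - g \<in> M" if "g \<in> M" "m \<in> M" "g \<subseteq># m" for g m
    proof -
      have "(\<lambda>i. e i + signed_count (m - g) i) \<in> E" if e: "e \<in> E" for e
      proof -
        \<comment> \<open>The affine combination of the translates of \<open>e\<close> by \<open>m\<close> and \<open>g\<close> with \<open>e\<close> itself.\<close>
        have "(\<lambda>i. e i + signed_count m i - (e i + signed_count g i) + e i) \<in> E"
          using \<open>g \<in> M\<close> \<open>m \<in> M\<close> e by (intro aff) (auto simp: M_def)
        then show ?thesis by (simp add: sc_diff[OF \<open>g \<subseteq># m\<close>] algebra_simps)
      qed
      then show ?thesis using \<open>m \<in> M\<close> by (auto simp: M_def dest: in_diffD)
    qed
    show "y - x \<in> M" if "x \<in> D" "y \<in> D" "x \<subseteq># y" for x y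
    proof -
      have "(\<lambda>i. e i + signed_count (y - x) i) \<in> E" if e: "e \<in> E" for e
        using aff[of "signed_count y" "signed_count x" e] \<open>x \<in> D\<close> \<open>y \<in> D\<close> e
        by (simp add: D_def sc_diff[OF \<open>x \<subseteq># y\<close>] algebra_simps)
      then show ?thesis using \<open>y \<in> D\<close> by (auto simp: M_def D_def dest: in_diffD)
    qed
    show "convex_along M D"
      unfolding convex_along_def
    proof (intro ballI impI)
      fix x m m' assume x: "x \<in> D" and m: "m \<in> M" and e: "x + m + m' \<in> D"
      have "(\<lambda>i. signed_count x i + signed_count m i) \<in> E"
        using x m by (simp add: M_def D_def)
      moreover have "signed_count (x + m) = (\<lambda>i. signed_count x i + signed_count m i)"
        by (simp add: fun_eq_iff sc_add)
      moreover have "reduced (x + m)" "set_mset (x + m) \<subseteq> I \<times> UNIV"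
        using e by (auto simp: D_def reduced_def)
      ultimately show "x + m \<in> D" by (simp add: D_def)
    qed
  qed (auto simp: M_def D_def)
  moreover have "E = signed_count ` D"
  proof
    show "E \<subseteq> signed_count ` D"
    proof
      fix e assume "e \<in> E"
      then show "e \<in> signed_count ` D"
        using reduced_ex[OF I, of e] supp unfolding D_def by blast
    qed
  qed (auto simp: D_def)
  moreover have "inj_on signed_count D"
  proof (rule inj_onI)
    fix x y assume "x \<in> D" "y \<in> D" and eq: "signed_count x = signed_count y"
    then have "reduced x" "reduced y" by (simp_all add: D_def)
    then have "count x (i, b) = count y (i, b)" for i b
      by (cases b) (simp_all add: reduced_count eq)
    then show "x = y" by (intro multiset_eqI) auto
  qed
  moreover have "l1_norm I (signed_count x) = 0 + size x" if "x \<in> D" for x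
    using size_reduced[OF _ I] that by (simp add: D_def)
  ultimately show ?thesis
    using counting_series_image[of signed_count D "l1_norm I" 0 size] by simp
qed

lemma finite_l1_norm_level:
  fixes E :: "('i \<Rightarrow> int) set"
  assumes I: "finite I" and supp: "\<And>e i. e \<in> E \<Longrightarrow> i \<notin> I \<Longrightarrow> e i = 0"
  shows "finite {e \<in> E. l1_norm I e = m}"
proof (rule finite_subset)
  show "{e \<in> E. l1_norm I e = m} \<subseteq> signed_count ` {x. set_mset x \<subseteq> I \<times> UNIV \<and> size x = m}"
  proof
    fix e assume e: "e \<in> {e \<in> E. l1_norm I e = m}"
    then obtain x where "reduced x" "set_mset x \<subseteq> I \<times> UNIV" "signed_count x = e"
      using reduced_ex[OF I, of e] supp by blast
    then show "e \<in> signed_count ` {x. set_mset x \<subseteq> I \<times> UNIV \<and> size x = m}"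
      using e size_reduced[OF _ I] by auto
  qed
  show "finite (signed_count ` {x. set_mset x \<subseteq> I \<times> UNIV \<and> size x = m})"
    using I by (intro finite_imageI finite_multisets_size) simp
qed


section \<open>Parallelograms in the cosets of an abelian normal subgroup\<close>

text \<open>Four points of one coset \<open>N q\<close> at which the opposite differences agree: with \<open>N\<close> written additively
and the coset as an affine space over \<open>N\<close>, this says \<open>s = p - q + r\<close>. For an abelian normal
subgroup these quadruples form a subgroup of \<open>G\<^sup>4\<close> that contains the diagonal, and this is what
makes equations over \<open>G\<close> affine in the exponents of the unknowns.\<close>

definition parallelogram ::
  "('a, 'b) monoid_scheme \<Rightarrow> 'a set \<Rightarrow> 'a \<Rightarrow> 'a \<Rightarrow> 'a \<Rightarrow> 'a \<Rightarrow> bool" where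
  "parallelogram G N p q r s \<longleftrightarrow> q \<in> carrier G \<and>
     (\<exists>x\<in>N. \<exists>y\<in>N. p = x \<otimes>\<^bsub>G\<^esub> q \<and> r = y \<otimes>\<^bsub>G\<^esub> q \<and> s = x \<otimes>\<^bsub>G\<^esub> y \<otimes>\<^bsub>G\<^esub> q)"

context normal
begin

lemma parallelogram_const:
  assumes "g \<in> carrier G"
  shows "parallelogram G H g g g g"
  unfolding parallelogram_def
  using assms by (intro conjI bexI[of _ "\<one>"]) simp_all

text \<open>Moving the elements of \<open>N\<close> in the second factor to the left past \<open>q\<close> conjugates them by \<open>q\<close>, which
keeps them in \<open>N\<close>; there they can be sorted by commutativity.\<close>

lemma parallelogram_mult:
  assumes comm: "\<And>x y. x \<in> H \<Longrightarrow> y \<in> H \<Longrightarrow> x \<otimes> y = y \<otimes> x"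
    and "parallelogram G H p q r s" "parallelogram G H p' q' r' s'"
  shows "parallelogram G H (p \<otimes> p') (q \<otimes> q') (r \<otimes> r') (s \<otimes> s')"
proof -
  obtain x y x' y' where xy: "x \<in> H" "y \<in> H" "x' \<in> H" "y' \<in> H"
    and q: "q \<in> carrier G" "q' \<in> carrier G"
    and p: "p = x \<otimes> q" "p' = x' \<otimes> q'" and r: "r = y \<otimes> q" "r' = y' \<otimes> q'"
    and s: "s = x \<otimes> y \<otimes> q" "s' = x' \<otimes> y' \<otimes> q'"
    using assms(2,3) unfolding parallelogram_def by blast
  have conj: "\<exists>w\<in>H. q \<otimes> z = w \<otimes> q" if "z \<in> H" for z
    using inv_op_closed2[OF q(1) that] mem_carrier[OF that] q(1)
    by (intro bexI[of _ "q \<otimes> z \<otimes> inv q"]) (simp_all add: m_assoc)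
  obtain x'' y'' where x'': "x'' \<in> H" "q \<otimes> x' = x'' \<otimes> q" and y'': "y'' \<in> H" "q \<otimes> y' = y'' \<otimes> q"
    using conj xy(3,4) by metis
  note G = mem_carrier[OF xy(1)] mem_carrier[OF xy(2)] mem_carrier[OF xy(3)] mem_carrier[OF xy(4)]
    mem_carrier[OF x''(1)] mem_carrier[OF y''(1)] q
  have move: "u \<otimes> q \<otimes> (z \<otimes> q') = u \<otimes> w \<otimes> (q \<otimes> q')"
    if "q \<otimes> z = w \<otimes> q" "u \<in> carrier G" "z \<in> carrier G" "w \<in> carrier G" for u z w
  proof -
    have "u \<otimes> q \<otimes> (z \<otimes> q') = u \<otimes> (q \<otimes> z) \<otimes> q'" using that(2-4) q by (simp add: m_assoc)
    also have "\<dots> = u \<otimes> w \<otimes> (q \<otimes> q')" unfolding that(1) using that(2-4) q by (simp add: m_assoc)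
    finally show ?thesis .
  qed
  have "q \<otimes> (x' \<otimes> y') = (q \<otimes> x') \<otimes> y'" using G by (simp add: m_assoc)
  also have "\<dots> = x'' \<otimes> (q \<otimes> y')" unfolding x''(2) using G by (simp add: m_assoc)
  also have "\<dots> = x'' \<otimes> y'' \<otimes> q" unfolding y''(2) using G by (simp add: m_assoc)
  finally have "s \<otimes> s' = x \<otimes> y \<otimes> (x'' \<otimes> y'') \<otimes> (q \<otimes> q')"
    unfolding s using G by (intro move) simp_all
  also have "x \<otimes> y \<otimes> (x'' \<otimes> y'') = x \<otimes> (y \<otimes> x'') \<otimes> y''" using G by (simp add: m_assoc)
  also have "\<dots> = x \<otimes> x'' \<otimes> (y \<otimes> y'')"
    unfolding comm[OF xy(2) x''(1)] using G by (simp add: m_assoc)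
  finally have "s \<otimes> s' = x \<otimes> x'' \<otimes> (y \<otimes> y'') \<otimes> (q \<otimes> q')" .
  moreover have "p \<otimes> p' = x \<otimes> x'' \<otimes> (q \<otimes> q')" "r \<otimes> r' = y \<otimes> y'' \<otimes> (q \<otimes> q')"
    unfolding p r using move x''(2) y''(2) G by blast+
  moreover have "q \<otimes> q' \<in> carrier G" "x \<otimes> x'' \<in> H" "y \<otimes> y'' \<in> H"
    using xy x'' y'' q by simp_all
  ultimately show ?thesis
    unfolding parallelogram_def by blast
qed

lemma parallelogram_inv:
  assumes comm: "\<And>x y. x \<in> H \<Longrightarrow> y \<in> H \<Longrightarrow> x \<otimes> y = y \<otimes> x"
    and "parallelogram G H p q r s"
  shows "parallelogram G H (inv p) (inv q) (inv r) (inv s)"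
proof -
  obtain x y where xy: "x \<in> H" "y \<in> H" and q: "q \<in> carrier G"
    and p: "p = x \<otimes> q" and r: "r = y \<otimes> q" and s: "s = x \<otimes> y \<otimes> q"
    using assms(2) unfolding parallelogram_def by blast
  let ?c = "\<lambda>z. inv q \<otimes> inv z \<otimes> q"
  note G = mem_carrier[OF xy(1)] mem_carrier[OF xy(2)]
  have cH: "?c z \<in> H" if "z \<in> H" for z using inv_op_closed1[OF q, of "inv z"] that by simp
  have inv: "inv (z \<otimes> q) = ?c z \<otimes> inv q" if "z \<in> H" for z
    using that q mem_carrier[OF that] by (simp add: m_assoc inv_mult_group)
  have "?c x \<otimes> ?c y = inv q \<otimes> inv x \<otimes> (q \<otimes> (inv q \<otimes> (inv y \<otimes> q)))"
    using G q by (simp add: m_assoc)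
  also have "q \<otimes> (inv q \<otimes> (inv y \<otimes> q)) = inv y \<otimes> q"
    using G q by (simp flip: m_assoc)
  also have "inv q \<otimes> inv x \<otimes> (inv y \<otimes> q) = ?c (x \<otimes> y)"
    unfolding comm[OF xy] using G q by (simp add: m_assoc inv_mult_group)
  finally have "inv s = ?c x \<otimes> ?c y \<otimes> inv q"
    unfolding s using inv[of "x \<otimes> y"] xy by simp
  then show ?thesis
    unfolding parallelogram_def p r using inv xy cH q by blast
qed

lemma parallelogram_one:
  assumes "parallelogram G H \<one> \<one> \<one> s"
  shows "s = \<one>"
proof -
  obtain x y where "x \<in> H" "y \<in> H" "\<one> = x \<otimes> \<one>" "\<one> = y \<otimes> \<one>" "s = x \<otimes> y \<otimes> \<one>"
    using assms unfolding parallelogram_def by blast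
  then show ?thesis using mem_carrier by (metis r_one one_closed)
qed

end


section \<open>Induction over free groups and free products\<close>

lemma presented_monoid_induct [consumes 1, case_names one gen mult]:
  assumes x: "x \<in> carrier (presented_monoid A R)"
    and one: "P \<one>\<^bsub>presented_monoid A R\<^esub>"
    and gen: "\<And>c. c \<in> A \<Longrightarrow> P (word_class A R [c])"
    and mult: "\<And>x y. x \<in> carrier (presented_monoid A R) \<Longrightarrow> y \<in> carrier (presented_monoid A R)
      \<Longrightarrow> P x \<Longrightarrow> P y \<Longrightarrow> P (x \<otimes>\<^bsub>presented_monoid A R\<^esub> y)"
  shows "P x"
proof -
  have "P (word_class A R u)" if "u \<in> lists A" for u
    using that
  proof induction
    case Nil
    then show ?case using one by (simp add: one_presented)
  next
    case (Cons c u)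
    then have cu: "[c] \<in> lists A" "u \<in> lists A" by auto
    then have "P (word_class A R [c] \<otimes>\<^bsub>presented_monoid A R\<^esub> word_class A R u)"
      using Cons by (intro mult gen) (auto simp: carrier_presented)
    then show ?case using mult_presented[OF cu, of R] by simp
  qed
  then show ?thesis using x by (auto simp: carrier_presented)
qed

lemma free_group_induct [consumes 1, case_names one gen inv mult]:
  assumes x: "x \<in> carrier (free_group V)"
    and one: "P \<one>\<^bsub>free_group V\<^esub>"
    and gen: "\<And>v. v \<in> V \<Longrightarrow> P (free_gen V v)"
    and inv: "\<And>x. x \<in> carrier (free_group V) \<Longrightarrow> P x \<Longrightarrow> P (inv\<^bsub>free_group V\<^esub> x)"
    and mult: "\<And>x y. x \<in> carrier (free_group V) \<Longrightarrow> y \<in> carrier (free_group V)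
      \<Longrightarrow> P x \<Longrightarrow> P y \<Longrightarrow> P (x \<otimes>\<^bsub>free_group V\<^esub> y)"
  shows "P x"
  using x unfolding free_group_def
proof (induction rule: presented_monoid_induct)
  case (gen c)
  then obtain v b where c: "c = (v, b)" "v \<in> V" by blast
  let ?c = "word_class (V \<times> UNIV) (free_group_rels V)"
  show ?case
  proof (cases b)
    case True
    then show ?thesis using assms(3)[OF c(2)] c(1) by (simp add: free_gen_def)
  next
    case False
    interpret F: group "free_group V" by (rule group_free_group)
    have "([(v, False), (v, True)], []) \<in> word_cong (V \<times> UNIV) (free_group_rels V)"
      using c(2) by (intro word_cong.rel) (auto simp: free_group_rels_def)
    then have "?c [(v, False)] \<otimes>\<^bsub>free_group V\<^esub> free_gen V v = \<one>\<^bsub>free_group V\<^esub>"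
      using c(2)
      by (simp add: free_group_def free_gen_def mult_presented one_presented word_class_eq_iff)
    then have "inv\<^bsub>free_group V\<^esub> (free_gen V v) = ?c [(v, False)]"
      using c(2) by (intro F.inv_equality) (auto simp: free_group_def carrier_presented free_gen_def)
    then show ?thesis
      using inv[OF free_gen_closed assms(3)] c False by metis
  qed
qed (use one mult in \<open>simp_all add: free_group_def\<close>)

lemma free_product_induct [consumes 1, case_names one inl inr mult]:
  assumes x: "x \<in> carrier (free_product G H)"
    and "P \<one>\<^bsub>free_product G H\<^esub>"
    and "\<And>g. g \<in> carrier G \<Longrightarrow> P (free_product_inl G H g)"
    and "\<And>h. h \<in> carrier H \<Longrightarrow> P (free_product_inr G H h)"
    and "\<And>x y. x \<in> carrier (free_product G H) \<Longrightarrow> y \<in> carrier (free_product G H)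
      \<Longrightarrow> P x \<Longrightarrow> P y \<Longrightarrow> P (x \<otimes>\<^bsub>free_product G H\<^esub> y)"
  shows "P x"
  using x unfolding free_product_def
  by (induction rule: presented_monoid_induct)
    (use assms(2-) in \<open>auto simp: free_product_def free_product_inl_def free_product_inr_def\<close>)


section \<open>Exponent vectors of solutions\<close>

lemma basis_product_cong:
  assumes "\<And>j. j \<in> {1..k} \<Longrightarrow> e j = e' j"
  shows "basis_product G k a e = basis_product G k a e'"
proof -
  have "map (\<lambda>j. a j [^]\<^bsub>G\<^esub> e j) [1..<Suc k] = map (\<lambda>j. a j [^]\<^bsub>G\<^esub> e' j) [1..<Suc k]"
    by (rule map_cong) (use assms in \<open>auto simp del: upt_Suc\<close>)
  then show ?thesis by (simp only: basis_product_def)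
qed

lemma basis_product_add:
  assumes G: "group G" and N: "subgroup N G" and basis: "free_abelian_basis G N k a"
  shows "basis_product G k a (\<lambda>j. e j + e' j)
    = basis_product G k a e \<otimes>\<^bsub>G\<^esub> basis_product G k a e'"
proof -
  let ?F = "free_Abelian_group {1..k}" and ?s = "\<lambda>e. \<Sum>j\<in>{1..k}. frag_cmul (e j) (frag_of j)"
  obtain \<phi> where \<phi>: "\<phi> \<in> hom ?F (G\<lparr>carrier := N\<rparr>)" "\<And>i. i \<in> {1..k} \<Longrightarrow> a i = \<phi> (frag_of i)"
    using basis by (auto simp: free_abelian_basis_def iso_def)
  have "frag_cmul m (frag_of j) \<in> carrier ?F" if "j \<in> {1..k}" for m j
    using that keys_cmul[of m "frag_of j"] by (auto simp: carrier_free_Abelian_group_iff)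
  then have sF: "?s e \<in> carrier ?F" for e
    by (auto simp: carrier_free_Abelian_group_iff intro!: order_trans[OF keys_sum])
  have "?s (\<lambda>j. e j + e' j) = ?s e + ?s e'"
    by (simp add: frag_cmul_distrib sum.distrib)
  then have "\<phi> (?s (\<lambda>j. e j + e' j)) = \<phi> (?s e) \<otimes>\<^bsub>G\<^esub> \<phi> (?s e')"
    using hom_mult[OF \<phi>(1) sF sF] by simp
  then show ?thesis using basis_product_iso[OF G N \<phi>] by simp
qed

text \<open>With the coset representatives \<open>t i\<close> of the values of the unknowns fixed, a solution is the same as a
table of exponents. The vectors vanish outside the relevant indices, so that distinct vectors give
distinct solutions.\<close>

definition solution_exponents ::
  "('a, 'b) monoid_scheme \<Rightarrow> nat \<Rightarrow> nat \<Rightarrow> (nat \<Rightarrow> 'a) \<Rightarrow> ('a + (nat \<times> bool) list set) list set set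
    \<Rightarrow> (nat \<Rightarrow> 'a) \<Rightarrow> (nat \<times> nat \<Rightarrow> int) set" where
  "solution_exponents G n k a W t =
     {e. (\<forall>c. c \<notin> {1..n} \<times> {1..k} \<longrightarrow> e c = 0)
       \<and> (\<exists>\<psi>. is_solution G {1..n} W \<psi>
         \<and> (\<forall>i\<in>{1..n}. \<psi> (free_gen {1..n} i) = basis_product G k a (\<lambda>j. e (i, j)) \<otimes>\<^bsub>G\<^esub> t i))}"

context
  fixes G :: "('a, 'b) monoid_scheme" and N T :: "'a set" and k :: nat and a :: "nat \<Rightarrow> 'a"
  assumes G: "group G" and N: "N \<lhd> G"
    and basis: "free_abelian_basis G N k a" and T: "right_transversal G N T"
begin

interpretation G: group G by (rule G)
interpretation N: normal N G by (rule N)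

lemma abelian_subgroup: "x \<in> N \<Longrightarrow> y \<in> N \<Longrightarrow> x \<otimes>\<^bsub>G\<^esub> y = y \<otimes>\<^bsub>G\<^esub> x"
proof -
  assume "x \<in> N" "y \<in> N"
  then obtain e e' where "x = basis_product G k a e" "y = basis_product G k a e'"
    using basis_product_surj[OF G N.subgroup_axioms basis T] by metis
  moreover have "basis_product G k a (\<lambda>j. e j + e' j) = basis_product G k a (\<lambda>j. e' j + e j)"
    by (simp add: add.commute)
  ultimately show ?thesis
    by (simp add: basis_product_add[OF G N.subgroup_axioms basis])
qed

text \<open>The quadruples forming a parallelogram are closed under the group operations, so it suffices to look
at generators. In a free product with \<open>G\<close>, the constants of \<open>G\<close> contribute diagonal quadruples.\<close>

lemma parallelogram_hom_free_group:
  assumes h: "p \<in> hom (free_group V) G" "q \<in> hom (free_group V) G"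
      "r \<in> hom (free_group V) G" "s \<in> hom (free_group V) G"
    and gen: "\<And>v. v \<in> V \<Longrightarrow> parallelogram G N (p (free_gen V v)) (q (free_gen V v))
      (r (free_gen V v)) (s (free_gen V v))"
    and u: "u \<in> carrier (free_group V)"
  shows "parallelogram G N (p u) (q u) (r u) (s u)"
  using u
proof (induction rule: free_group_induct)
  case one
  then show ?case
    using hom_one[OF _ group_free_group G] h N.parallelogram_const[OF G.one_closed] by metis
next
  case (inv x)
  have "f (inv\<^bsub>free_group V\<^esub> x) = inv\<^bsub>G\<^esub> (f x)" if "f \<in> hom (free_group V) G" for f
    using group_hom.hom_inv[OF group_hom.intro[OF group_free_group G group_hom_axioms.intro[OF that]]]
      inv(1) .
  then show ?case
    using N.parallelogram_inv[OF abelian_subgroup inv(2)] h by simp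
next
  case (mult x y)
  have "f (x \<otimes>\<^bsub>free_group V\<^esub> y) = f x \<otimes>\<^bsub>G\<^esub> f y" if "f \<in> hom (free_group V) G" for f
    using hom_mult[OF that mult(1,2)] .
  then show ?case
    using N.parallelogram_mult[OF abelian_subgroup mult(3,4)] h by simp
qed (use gen in blast)

lemma parallelogram_hom_free_product:
  assumes F: "group F"
    and p: "extends_by_identity G F p p'" and q: "extends_by_identity G F q q'"
    and r: "extends_by_identity G F r r'" and s: "extends_by_identity G F s s'"
    and F_par: "\<And>u. u \<in> carrier F \<Longrightarrow> parallelogram G N (p u) (q u) (r u) (s u)"
    and w: "w \<in> carrier (free_product G F)"
  shows "parallelogram G N (p' w) (q' w) (r' w) (s' w)"
proof -
  have hom: "p' \<in> hom (free_product G F) G" "q' \<in> hom (free_product G F) G"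
    "r' \<in> hom (free_product G F) G" "s' \<in> hom (free_product G F) G"
    using p q r s by (simp_all add: extends_by_identity_def)
  show ?thesis
    using w
  proof (induction rule: free_product_induct)
    case one
    then show ?case
      using hom_one[OF _ group_free_product[OF G F] G] hom N.parallelogram_const[OF G.one_closed] by metis
  next
    case (inl g)
    then show ?case
      using p q r s N.parallelogram_const by (simp add: extends_by_identity_def)
  next
    case (inr u)
    then show ?case
      using p q r s F_par by (simp add: extends_by_identity_def)
  next
    case (mult x y)
    have "f (x \<otimes>\<^bsub>free_product G F\<^esub> y) = f x \<otimes>\<^bsub>G\<^esub> f y"
      if "f \<in> hom (free_product G F) G" for f
      using hom_mult[OF that mult(1,2)] .
    then show ?case
      using N.parallelogram_mult[OF abelian_subgroup mult(3,4)] hom by simp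
  qed
qed

text \<open>For three solutions with exponents \<open>x\<close>, \<open>y\<close>, \<open>z\<close>, let \<open>s\<close> assign to the unknowns the values with
exponents \<open>x - y + z\<close>. The four values of each unknown form a parallelogram, hence so do the four
values of each \<open>w \<in> W\<close>. Three of these are trivial, so the fourth is trivial too.\<close>

lemma affine_solution_exponents:
  assumes W: "W \<subseteq> carrier (free_product G (free_group {1..n}))"
    and t: "\<And>i. i \<in> {1..n} \<Longrightarrow> t i \<in> carrier G"
  shows "affine_int_set (solution_exponents G n k a W t)"
  unfolding affine_int_set_def
proof (intro ballI)
  let ?E = "solution_exponents G n k a W t" and ?V = "{1..n}"
  let ?F = "free_group ?V"
  let ?g = "\<lambda>e i. basis_product G k a (\<lambda>j. e (i, j)) \<otimes>\<^bsub>G\<^esub> t i"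
  fix x y z assume xyz: "x \<in> ?E" "y \<in> ?E" "z \<in> ?E"
  define v where "v = (\<lambda>c. x c - y c + z c)"
  have bG: "basis_product G k a e \<in> carrier G" for e
    using basis_product_closed[OF G N.subgroup_axioms basis T] N.mem_carrier by blast
  have sol: "\<exists>\<psi> \<psi>'. \<psi> \<in> hom ?F G \<and> extends_by_identity G ?F \<psi> \<psi>' \<and> (\<forall>w\<in>W. \<psi>' w = \<one>\<^bsub>G\<^esub>)
      \<and> (\<forall>i\<in>?V. \<psi> (free_gen ?V i) = ?g e i)" if "e \<in> ?E" for e
    using that unfolding solution_exponents_def is_solution_def by blast
  obtain p p' where p: "p \<in> hom ?F G" "extends_by_identity G ?F p p'" "\<forall>w\<in>W. p' w = \<one>\<^bsub>G\<^esub>"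
    "\<forall>i\<in>?V. p (free_gen ?V i) = ?g x i" using sol[OF xyz(1)] by blast
  obtain q q' where q: "q \<in> hom ?F G" "extends_by_identity G ?F q q'" "\<forall>w\<in>W. q' w = \<one>\<^bsub>G\<^esub>"
    "\<forall>i\<in>?V. q (free_gen ?V i) = ?g y i" using sol[OF xyz(2)] by blast
  obtain r r' where r: "r \<in> hom ?F G" "extends_by_identity G ?F r r'" "\<forall>w\<in>W. r' w = \<one>\<^bsub>G\<^esub>"
    "\<forall>i\<in>?V. r (free_gen ?V i) = ?g z i" using sol[OF xyz(3)] by blast
  have "?g v \<in> ?V \<rightarrow> carrier G" using bG t by simp
  then obtain s where s: "s \<in> hom ?F G" "\<And>i. i \<in> ?V \<Longrightarrow> s (free_gen ?V i) = ?g v i"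
    using free_group_lift[OF G] by blast
  obtain s' where s': "extends_by_identity G ?F s s'"
    using extends_by_identity_ex[OF G group_free_group s(1)] by blast
  have gen: "parallelogram G N (p (free_gen ?V i)) (q (free_gen ?V i)) (r (free_gen ?V i)) (s (free_gen ?V i))"
    if i: "i \<in> ?V" for i
  proof -
    let ?b = "\<lambda>e. basis_product G k a (\<lambda>j. e (i, j))"
    \<comment> \<open>The two sides of the parallelogram at the corner \<open>?g y i\<close>.\<close>
    let ?xy = "?b (\<lambda>c. x c - y c)" and ?zy = "?b (\<lambda>c. z c - y c)"
    note add = basis_product_add[OF G N.subgroup_axioms basis, symmetric]
    have eq: "?b x = ?xy \<otimes>\<^bsub>G\<^esub> ?b y" "?b z = ?zy \<otimes>\<^bsub>G\<^esub> ?b y" "?b v = ?xy \<otimes>\<^bsub>G\<^esub> ?b z"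
      by (simp_all add: add v_def)
    have "?g x i = ?xy \<otimes>\<^bsub>G\<^esub> ?g y i" "?g z i = ?zy \<otimes>\<^bsub>G\<^esub> ?g y i"
      "?g v i = ?xy \<otimes>\<^bsub>G\<^esub> ?zy \<otimes>\<^bsub>G\<^esub> ?g y i"
      unfolding eq by (simp_all only: G.m_assoc bG t[OF i] G.m_closed)
    moreover have "?xy \<in> N" "?zy \<in> N"
      using basis_product_closed[OF G N.subgroup_axioms basis T] by blast+
    moreover have "?g y i \<in> carrier G" using bG t[OF i] by simp
    ultimately have "parallelogram G N (?g x i) (?g y i) (?g z i) (?g v i)"
      unfolding parallelogram_def by blast
    then show ?thesis
      using i p(4) q(4) r(4) s(2) by (simp only: ball_simps)
  qed
  have "parallelogram G N (p' w) (q' w) (r' w) (s' w)" if "w \<in> W" for w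
    using parallelogram_hom_free_product[OF group_free_group p(2) q(2) r(2) s'
        parallelogram_hom_free_group[OF p(1) q(1) r(1) s(1) gen]] W that by blast
  then have "\<forall>w\<in>W. s' w = \<one>\<^bsub>G\<^esub>"
    using p(3) q(3) r(3) N.parallelogram_one by metis
  then have "is_solution G ?V W s"
    using s(1) s' unfolding is_solution_def by blast
  moreover have "\<forall>c. c \<notin> ?V \<times> {1..k} \<longrightarrow> v c = 0"
    using xyz by (simp add: solution_exponents_def v_def)
  ultimately have "v \<in> ?E"
    using s(2) unfolding solution_exponents_def by blast
  then show "(\<lambda>c. x c - y c + z c) \<in> ?E" by (simp add: v_def)
qed

end


section \<open>Solution words\<close>

text \<open>The truncated subtraction is right for the empty list as well: it has no separators.\<close>

lemma length_hash_join: "length (hash_join ws) = sum_list (map length ws) + (length ws - 1)"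
  by (induction ws rule: hash_join.induct) auto

lemma Letter_Hash_eq_iff:
  "map Letter u @ Hash # x = map Letter v @ Hash # y \<longleftrightarrow> u = v \<and> x = y"
proof (induction u arbitrary: v)
  case Nil
  then show ?case by (cases v) auto
next
  case (Cons c u)
  then show ?case by (cases v) auto
qed

lemma hash_join_inj:
  assumes "length us = length vs" "hash_join us = hash_join vs"
  shows "us = vs"
  using assms
proof (induction us arbitrary: vs rule: hash_join.induct)
  case 1
  then show ?case by simp
next
  case (2 w)
  then obtain v where "vs = [v]" by (auto simp: Suc_length_conv)
  then show ?case using 2 by (simp add: inj_map_eq_map inj_def)
next
  case (3 u u' us)
  then have "length vs = Suc (Suc (length us))" by simp
  then obtain v v' vs' where vs: "vs = v # v' # vs'" by (auto simp: length_Suc_conv)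
  then have "u = v \<and> hash_join (u' # us) = hash_join (v' # vs')"
    using 3(3) by (simp add: Letter_Hash_eq_iff)
  then show ?case using 3(1)[of "v' # vs'"] 3(2) unfolding vs by simp
qed

lemma length_basis_word: "length (basis_word G k a e) = (\<Sum>j\<in>{1..k}. nat \<bar>e j\<bar>)"
proof -
  have "length (power_word G x m) = nat \<bar>m\<bar>" for x m by (simp add: power_word_def)
  then have "length (basis_word G k a e) = sum_list (map (\<lambda>j. nat \<bar>e j\<bar>) [1..<Suc k])"
    by (simp add: basis_word_def length_concat comp_def del: upt_Suc)
  then show ?thesis
    by (simp add: interv_sum_list_conv_sum_set_nat atLeastLessThanSuc_atLeastAtMost del: upt_Suc)
qed

definition solution_word ::
  "('a, 'b) monoid_scheme \<Rightarrow> nat \<Rightarrow> nat \<Rightarrow> (nat \<Rightarrow> 'a) \<Rightarrow> 'a set \<Rightarrow> (nat \<Rightarrow> 'a)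
    \<Rightarrow> (nat \<times> nat \<Rightarrow> int) \<Rightarrow> 'a letter list" where
  "solution_word G n k a T t e =
     hash_join (map (\<lambda>i. zeta G k a T (basis_product G k a (\<lambda>j. e (i, j)) \<otimes>\<^bsub>G\<^esub> t i)) [1..<Suc n])"

context
  fixes G :: "('a, 'b) monoid_scheme" and N T :: "'a set" and k :: nat and a :: "nat \<Rightarrow> 'a"
  assumes G: "group G" and N: "N \<lhd> G"
    and basis: "free_abelian_basis G N k a" and T: "right_transversal G N T"
begin

interpretation G: group G by (rule G)
interpretation N: normal N G by (rule N)

lemma finite_transversal:
  assumes "finite (rcosets\<^bsub>G\<^esub> N)"
  shows "finite T"
proof (rule inj_on_finite[OF _ _ assms])
  have TG: "t \<in> carrier G" if "t \<in> T" for t using T that by (auto simp: right_transversal_def)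
  show cosets: "(\<lambda>t. N #>\<^bsub>G\<^esub> t) ` T \<subseteq> rcosets\<^bsub>G\<^esub> N"
    using TG G.rcosetsI[OF N.subset] by blast
  show "inj_on (\<lambda>t. N #>\<^bsub>G\<^esub> t) T"
  proof (rule inj_onI)
    fix t t' assume t: "t \<in> T" "t' \<in> T" and eq: "N #>\<^bsub>G\<^esub> t = N #>\<^bsub>G\<^esub> t'"
    have "t \<in> N #>\<^bsub>G\<^esub> t" "t' \<in> N #>\<^bsub>G\<^esub> t"
      using G.rcos_self[OF TG N.subgroup_axioms] t eq by auto
    moreover have "N #>\<^bsub>G\<^esub> t \<in> rcosets\<^bsub>G\<^esub> N" using cosets t(1) by blast
    ultimately show "t = t'" using T t unfolding right_transversal_def by blast
  qed
qed

lemma length_solution_word: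
  assumes t: "\<And>i. i \<in> {1..n} \<Longrightarrow> t i \<in> T"
  shows "length (solution_word G n k a T t e) = (n + (n - 1)) + l1_norm ({1..n} \<times> {1..k}) e"
proof -
  have "length (zeta G k a T (basis_product G k a (\<lambda>j. e (i, j)) \<otimes>\<^bsub>G\<^esub> t i))
      = (\<Sum>j\<in>{1..k}. nat \<bar>e (i, j)\<bar>) + 1" if "i \<in> {1..n}" for i
    using zeta_eq[OF G N.subgroup_axioms basis T t[OF that]] by (simp add: length_basis_word)
  then have "sum_list (map (\<lambda>i. length (zeta G k a T
        (basis_product G k a (\<lambda>j. e (i, j)) \<otimes>\<^bsub>G\<^esub> t i))) [1..<Suc n])
      = (\<Sum>i\<in>{1..n}. (\<Sum>j\<in>{1..k}. nat \<bar>e (i, j)\<bar>) + 1)"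
    by (simp add: interv_sum_list_conv_sum_set_nat atLeastLessThanSuc_atLeastAtMost del: upt_Suc)
  also have "\<dots> = l1_norm ({1..n} \<times> {1..k}) e + n"
    unfolding sum.distrib by (simp add: l1_norm_def sum.cartesian_product')
  finally show ?thesis
    by (simp add: solution_word_def length_hash_join comp_def del: upt_Suc)
qed

lemma solution_word_inj:
  assumes t: "\<And>i. i \<in> {1..n} \<Longrightarrow> t i \<in> T" and t': "\<And>i. i \<in> {1..n} \<Longrightarrow> t' i \<in> T"
    and eq: "solution_word G n k a T t e = solution_word G n k a T t' e'"
    and i: "i \<in> {1..n}"
  shows "t i = t' i" and "j \<in> {1..k} \<Longrightarrow> e (i, j) = e' (i, j)"
proof -
  let ?g = "\<lambda>t e. basis_product G k a (\<lambda>j. e (i, j)) \<otimes>\<^bsub>G\<^esub> t i"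
  have "map (\<lambda>i. zeta G k a T (basis_product G k a (\<lambda>j. e (i, j)) \<otimes>\<^bsub>G\<^esub> t i)) [1..<Suc n]
      = map (\<lambda>i. zeta G k a T (basis_product G k a (\<lambda>j. e' (i, j)) \<otimes>\<^bsub>G\<^esub> t' i)) [1..<Suc n]"
    using eq unfolding solution_word_def by (intro hash_join_inj) simp_all
  then have "zeta G k a T (?g t e) = zeta G k a T (?g t' e')"
    using i by (auto simp: map_eq_conv simp del: upt_Suc)
  moreover have "?g t e \<in> carrier G" if "t i \<in> T" for t e
    using that T basis_product_closed[OF G N.subgroup_axioms basis T] N.mem_carrier
    by (auto simp: right_transversal_def)
  ultimately have "?g t e = ?g t' e'"
    using eval_zeta[OF G N.subgroup_axioms basis T] t[OF i] t'[OF i] by metis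
  then show "t i = t' i" and "j \<in> {1..k} \<Longrightarrow> e (i, j) = e' (i, j)"
    using normal_form_unique[OF G N.subgroup_axioms basis T t[OF i] t'[OF i]] by blast+
qed

text \<open>Writing each value of a solution in the form \<open>a\<^sub>1\<^bsup>e\<^sub>1\<^esup> \<dots> a\<^sub>k\<^bsup>e\<^sub>k\<^esup> t\<close> sorts the solutions by the tuple of
coset representatives that occur.\<close>

lemma joined_solution_language_eq:
  "joined_solution_language G n (zeta G k a T) W
    = (\<Union>t\<in>{1..n} \<rightarrow>\<^sub>E T. solution_word G n k a T t ` solution_exponents G n k a W t)"
    (is "?L = ?R")
proof
  show "?R \<subseteq> ?L"
  proof
    fix w assume "w \<in> ?R"
    then obtain t e \<psi> where w: "w = solution_word G n k a T t e" and sol: "is_solution G {1..n} W \<psi>"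
      and \<psi>: "\<forall>i\<in>{1..n}. \<psi> (free_gen {1..n} i) = basis_product G k a (\<lambda>j. e (i, j)) \<otimes>\<^bsub>G\<^esub> t i"
      by (auto simp: solution_exponents_def)
    have "w = hash_join (map (\<lambda>i. zeta G k a T (\<psi> (free_gen {1..n} i))) [1..<Suc n])"
      unfolding w solution_word_def
      by (rule arg_cong[of _ _ hash_join], rule map_cong) (use \<psi> in \<open>auto simp del: upt_Suc\<close>)
    then show "w \<in> ?L" using sol unfolding joined_solution_language_def by blast
  qed
next
  show "?L \<subseteq> ?R"
  proof
    fix w assume "w \<in> ?L"
    then obtain \<psi> where sol: "is_solution G {1..n} W \<psi>"
      and w: "w = hash_join (map (\<lambda>i. zeta G k a T (\<psi> (free_gen {1..n} i))) [1..<Suc n])"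
      unfolding joined_solution_language_def by blast
    have "\<psi> (free_gen {1..n} i) \<in> carrier G" if "i \<in> {1..n}" for i
      using sol hom_carrier free_gen_closed[OF that] unfolding is_solution_def by blast
    then have "\<forall>i\<in>{1..n}. \<exists>e t. t \<in> T \<and> \<psi> (free_gen {1..n} i) = basis_product G k a e \<otimes>\<^bsub>G\<^esub> t"
      using normal_form_ex[OF G N.subgroup_axioms basis T] by blast
    then obtain e t where et: "\<forall>i\<in>{1..n}. t i \<in> T
        \<and> \<psi> (free_gen {1..n} i) = basis_product G k a (e i) \<otimes>\<^bsub>G\<^esub> t i"
      by metis
    define t' where "t' = restrict t {1..n}"
    define e' where "e' = (\<lambda>(i, j). if i \<in> {1..n} \<and> j \<in> {1..k} then e i j else 0)"
    have "basis_product G k a (\<lambda>j. e' (i, j)) = basis_product G k a (e i)" if "i \<in> {1..n}" for i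
      by (rule basis_product_cong) (use that in \<open>simp add: e'_def\<close>)
    then have \<psi>: "\<psi> (free_gen {1..n} i) = basis_product G k a (\<lambda>j. e' (i, j)) \<otimes>\<^bsub>G\<^esub> t' i"
      if "i \<in> {1..n}" for i
      using et that by (simp add: t'_def)
    then have "e' \<in> solution_exponents G n k a W t'"
      using sol unfolding solution_exponents_def by (auto simp: e'_def)
    moreover have "t' \<in> {1..n} \<rightarrow>\<^sub>E T" using et by (auto simp: t'_def)
    moreover have "w = solution_word G n k a T t' e'"
      unfolding w solution_word_def
      by (rule arg_cong[of _ _ hash_join], rule map_cong) (use \<psi> in \<open>auto simp del: upt_Suc\<close>)
    ultimately show "w \<in> ?R" by blast
  qed
qed

end

theorem proposition3p17:
  fixes G :: "('a, 'b) monoid_scheme" and N T :: "'a set" and k n :: nat and a :: "nat \<Rightarrow> 'a"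
    and W :: "('a + (nat \<times> bool) list set) list set set"
  assumes "group G"
    and "finitely_generated G"
    and "N \<lhd> G"
    and "finite (rcosets\<^bsub>G\<^esub> N)"
    and "free_abelian_basis G N k a"
    and "right_transversal G N T"
    and "finite_system G {1..n} W"
  shows "rational_fps (growth_series (joined_solution_language G n (zeta G k a T) W))"
proof -
  note ctx = assms(1,3,5,6)
  let ?S = "{1..n} \<rightarrow>\<^sub>E T" and ?I = "{1..n} \<times> {1..k}"
  let ?E = "solution_exponents G n k a W" and ?word = "solution_word G n k a T"
  have supp: "e c = 0" if "e \<in> ?E t" "c \<notin> ?I" for e c t
    using that unfolding solution_exponents_def by blast
  have len: "length (?word t e) = (n + (n - 1)) + l1_norm ?I e" if "t \<in> ?S" for t e
    by (rule length_solution_word[OF ctx]) (use that in auto)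
  have inj: "t = t'" "e = e'"
    if "t \<in> ?S" "t' \<in> ?S" "e \<in> ?E t" "e' \<in> ?E t'" "?word t e = ?word t' e'" for t t' e e'
  proof -
    have eq: "t i = t' i" "j \<in> {1..k} \<Longrightarrow> e (i, j) = e' (i, j)" if "i \<in> {1..n}" for i j
      using solution_word_inj[OF ctx _ _ \<open>?word t e = ?word t' e'\<close> that] \<open>t \<in> ?S\<close> \<open>t' \<in> ?S\<close>
      by blast+
    show "t = t'" using PiE_ext[OF \<open>t \<in> ?S\<close> \<open>t' \<in> ?S\<close>] eq(1) by blast
    have "e c = e' c" for c
      using eq(2)[of "fst c" "snd c"] supp[OF \<open>e \<in> ?E t\<close>, of c] supp[OF \<open>e' \<in> ?E t'\<close>, of c]
      by (cases c; cases "c \<in> ?I") auto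
    then show "e = e'" by blast
  qed
  have "rational_fps (counting_series length (\<Union>t\<in>?S. ?word t ` ?E t))"
  proof (rule rational_counting_series_UN_disjoint)
    show "finite ?S"
      using finite_transversal[OF ctx assms(4)] by (simp add: finite_PiE)
    show "disjoint_family_on (\<lambda>t. ?word t ` ?E t) ?S"
      unfolding disjoint_family_on_def using inj(1) by blast
  next
    fix t assume t: "t \<in> ?S"
    have "t i \<in> carrier G" if "i \<in> {1..n}" for i
      using t that assms(6) by (auto simp: right_transversal_def)
    then have "affine_int_set (?E t)"
      using affine_solution_exponents[OF ctx] assms(7) by (simp add: finite_system_def)
    then have "rational_fps (counting_series (l1_norm ?I) (?E t))"
      using supp by (intro rational_counting_series_affine) auto
    moreover have "inj_on (?word t) (?E t)"
      using inj(2)[OF t t] by (rule inj_onI)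
    ultimately show "rational_fps (counting_series length (?word t ` ?E t))"
      using counting_series_image[of "?word t" "?E t" length, OF _ len[OF t]]
      by (simp add: rational_fps_X_power_mult)
  next
    fix t m assume t: "t \<in> ?S"
    have "{w \<in> ?word t ` ?E t. length w = m} \<subseteq> ?word t ` {e \<in> ?E t. l1_norm ?I e = m - (n + (n - 1))}"
      using len[OF t] by auto
    then show "finite {w \<in> ?word t ` ?E t. length w = m}"
      by (rule finite_subset) (use finite_l1_norm_level[of ?I "?E t"] supp in simp)
  qed
  then show ?thesis
    by (simp add: joined_solution_language_eq[OF ctx] growth_series_def counting_series_def)
qed

end
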